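(* Temporal Hamiltonian Path can be solved in time $O(\Lambda^2 n^3 3^{2\omega})$, where $\Lambda$ is the lifetime of the input temporal graph, $n$ its number of vertices, and $\omega$ its VIM width.
   Context: A temporal graph $\mathcal{G}=(G,\lambda)$: static graph $G=(V,E)$ and $\lambda:E\to 2^{\mathbb{N}}$; time-edges $(e,t)$ with $t\in\lambda(e)$; lifetime $\Lambda=\max_e\max\lambda(e)$. A (strict) temporal path is a sequence of time-edges $(e_0,t_0),\dots,(e_l,t_l)$ forming a walk in $G$ with $t_i<t_{i+1}$ for all $i$, in which each vertex is traversed at most once. Temporal Hamiltonian Path: given a temporal graph $\mathcal{G}$, decide whether there is a temporal path in $\mathcal{G}$ containing every vertex. VIM width: with $F_t=\{v:\exists u,w,\ \min\lambda(vu)\le t\le\max\lambda(vw)\}$ for $t\in[\Lambda]$, $\omega=\max_{t\in[\Lambda]}|F_t|$. *)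

theory Defs
  imports Main
begin

section \<open>Temporal graphs\<close>

text \<open>Edges are two-element vertex sets; \<open>labels e\<close> is only meaningful for \<open>e\<close> in \<open>edges\<close>.\<close>

record 'v tgraph =
  verts :: "'v set"
  edges :: "'v set set"
  labels :: "'v set \<Rightarrow> nat set"

text \<open>Times are positive, matching the range \<open>{1..lifetime}\<close> over which the width is taken.
  A static edge may have no time label at all.\<close>

definition temporal_graph :: "'v tgraph \<Rightarrow> bool" where
  "temporal_graph G \<longleftrightarrow>
     finite (verts G) \<and>
     (\<forall>e\<in>edges G. e \<subseteq> verts G \<and> card e = 2 \<and> finite (labels G e) \<and> 0 \<notin> labels G e)"

definition active_edges :: "'v tgraph \<Rightarrow> 'v set set" where
  "active_edges G = {e \<in> edges G. labels G e \<noteq> {}}"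

text \<open>The following two maxima are meaningful only if \<open>active_edges G\<close> is nonempty;
  edges without labels have no minimum or maximum and are ignored.\<close>

definition lifetime :: "'v tgraph \<Rightarrow> nat" where
  "lifetime G = Max ((\<lambda>e. Max (labels G e)) ` active_edges G)"

definition vim_set :: "'v tgraph \<Rightarrow> nat \<Rightarrow> 'v set" where
  "vim_set G t = {v. \<exists>u w. {v, u} \<in> active_edges G \<and> {v, w} \<in> active_edges G \<and>
                       Min (labels G {v, u}) \<le> t \<and> t \<le> Max (labels G {v, w})}"

definition vim_width :: "'v tgraph \<Rightarrow> nat" where
  "vim_width G = Max ((\<lambda>t. card (vim_set G t)) ` {1..lifetime G})"

text \<open>\<open>vs\<close> lists the vertices met by the sequence \<open>p\<close> of time-edges, in order of traversal.
  The sequence \<open>p\<close> may be empty; this matters only for graphs with a single vertex.\<close>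

definition temporal_path :: "'v tgraph \<Rightarrow> 'v list \<Rightarrow> ('v set \<times> nat) list \<Rightarrow> bool" where
  "temporal_path G vs p \<longleftrightarrow>
     length vs = Suc (length p) \<and> set vs \<subseteq> verts G \<and> distinct vs \<and>
     (\<forall>i<length p. fst (p ! i) = {vs ! i, vs ! Suc i} \<and>
        fst (p ! i) \<in> edges G \<and> snd (p ! i) \<in> labels G (fst (p ! i))) \<and>
     (\<forall>i. Suc i < length p \<longrightarrow> snd (p ! i) < snd (p ! Suc i))"

definition temporal_hamiltonian :: "'v tgraph \<Rightarrow> bool" where
  "temporal_hamiltonian G \<longleftrightarrow> (\<exists>vs p. temporal_path G vs p \<and> verts G \<subseteq> set vs)"


section \<open>Uniform-cost random access machine\<close>

text \<open>A structured RAM over the natural numbers, with registers, an indirectly addressed memory,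
  addition and truncated subtraction. Multiplication and bitwise operations are deliberately
  not unit-cost primitives, since together with unbounded cells they would make the
  uniform cost measure unreasonable.\<close>

type_synonym reg = nat
type_synonym state = "(reg \<Rightarrow> nat) \<times> (nat \<Rightarrow> nat)"

datatype test = Less reg reg | Equal reg reg

datatype com =
    Skip
  | Const reg nat
  | Move reg reg
  | Add reg reg reg
  | Sub reg reg reg
  | Load reg reg
  | Store reg reg
  | Seq com com
  | Cond test com com
  | While test com

fun holds :: "test \<Rightarrow> (reg \<Rightarrow> nat) \<Rightarrow> bool" where
  "holds (Less i j) r \<longleftrightarrow> r i < r j"
| "holds (Equal i j) r \<longleftrightarrow> r i = r j"

text \<open>\<open>exec c s k s'\<close>: started in \<open>s\<close>, the program \<open>c\<close> halts in \<open>s'\<close> after exactly \<open>k\<close> steps.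
  The first argument of an instruction is its destination; that of \<open>Store\<close> holds the
  destination address.\<close>

inductive exec :: "com \<Rightarrow> state \<Rightarrow> nat \<Rightarrow> state \<Rightarrow> bool" where
  Skip: "exec Skip s 1 s"
| Const: "exec (Const i a) (r, m) 1 (r(i := a), m)"
| Move: "exec (Move i j) (r, m) 1 (r(i := r j), m)"
| Add: "exec (Add i j k) (r, m) 1 (r(i := r j + r k), m)"
| Sub: "exec (Sub i j k) (r, m) 1 (r(i := r j - r k), m)"
| Load: "exec (Load i j) (r, m) 1 (r(i := m (r j)), m)"
| Store: "exec (Store i j) (r, m) 1 (r, m(r i := r j))"
| Seq: "exec c s k s' \<Longrightarrow> exec d s' l s'' \<Longrightarrow> exec (Seq c d) s (k + l) s''"
| CondTrue: "holds b (fst s) \<Longrightarrow> exec c s k s' \<Longrightarrow> exec (Cond b c d) s (Suc k) s'"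
| CondFalse: "\<not> holds b (fst s) \<Longrightarrow> exec d s k s' \<Longrightarrow> exec (Cond b c d) s (Suc k) s'"
| WhileFalse: "\<not> holds b (fst s) \<Longrightarrow> exec (While b c) s 1 s"
| WhileTrue: "holds b (fst s) \<Longrightarrow> exec c s k s' \<Longrightarrow> exec (While b c) s' l s'' \<Longrightarrow>
    exec (While b c) s (Suc (k + l)) s''"

inductive_cases exec_SkipE: "exec Skip s k s'"
inductive_cases exec_ConstE: "exec (Const i a) s k s'"
inductive_cases exec_MoveE: "exec (Move i j) s k s'"
inductive_cases exec_AddE: "exec (Add i j h) s k s'"
inductive_cases exec_SubE: "exec (Sub i j h) s k s'"
inductive_cases exec_LoadE: "exec (Load i j) s k s'"
inductive_cases exec_StoreE: "exec (Store i j) s k s'"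
inductive_cases exec_SeqE: "exec (Seq c d) s k s'"
inductive_cases exec_CondE: "exec (Cond b c d) s k s'"
inductive_cases exec_WhileE: "exec (While b c) s k s'"

lemma exec_deterministic:
  "exec c s k s' \<Longrightarrow> exec c s l s'' \<Longrightarrow> l = k \<and> s'' = s'"
proof (induction arbitrary: l s'' rule: exec.induct)
  case Seq
  from Seq.prems show ?case by (rule exec_SeqE) (use Seq.IH in blast)
next
  case CondTrue
  from CondTrue.prems show ?case by (rule exec_CondE) (use CondTrue.IH CondTrue.hyps in blast)+
next
  case CondFalse
  from CondFalse.prems show ?case by (rule exec_CondE) (use CondFalse.IH CondFalse.hyps in blast)+
next
  case WhileFalse
  from WhileFalse.prems show ?case by (rule exec_WhileE) (use WhileFalse.hyps in auto)
next
  case WhileTrue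
  from WhileTrue.prems show ?case by (rule exec_WhileE) (use WhileTrue.IH WhileTrue.hyps in blast)+
qed (auto elim: exec_SkipE exec_ConstE exec_MoveE exec_AddE exec_SubE exec_LoadE exec_StoreE)

definition initial_state :: "nat list \<Rightarrow> state" where
  "initial_state xs = ((\<lambda>_. 0), (\<lambda>a. if a < length xs then xs ! a else 0))"

definition accepting :: "state \<Rightarrow> bool" where
  "accepting s \<longleftrightarrow> fst s 0 = 1"


section \<open>Temporal graphs as machine input\<close>

text \<open>The vertices of an instance are \<open>0, \<dots>, n - 1\<close>. The input is \<open>n\<close>, the number of static
  edges, and then for each edge its two endpoints, the number of its labels, and the labels.
  Edges, endpoints and labels may come in any order.\<close>

definition encodes :: "nat list \<Rightarrow> nat tgraph \<Rightarrow> bool" where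
  "encodes xs G \<longleftrightarrow>
     (\<exists>n es. verts G = {..<n} \<and>
        distinct (map (\<lambda>(u, v, ts). {u, v}) es) \<and>
        edges G = set (map (\<lambda>(u, v, ts). {u, v}) es) \<and>
        (\<forall>(u, v, ts) \<in> set es. distinct ts \<and> set ts = labels G {u, v}) \<and>
        xs = n # length es # concat (map (\<lambda>(u, v, ts). u # v # length ts # ts) es))"

end

theory Submission
  imports Defs "HOL-Library.Nat_Bijection"
begin

text \<open>Breadth-first search over triples of a time \<open>t\<close>, the set \<open>A\<close> of visited vertices and the current
  vertex. A triple is expanded only if every unvisited vertex still has an arc after time \<open>t\<close>; then
  \<open>A\<close> is determined by its trace on the VIM set, and at most
  \<open>K = n + \<Lambda> n + \<Lambda> 2\<^sup>\<omega> n\<close> triples arise. There is room for slow data structures: each of the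
  at most \<open>K (n + 1)\<close> insertions may search the whole queue, which costs
  \<open>O(n K\<^sup>2) = O(\<Lambda>\<^sup>2 n\<^sup>3 4\<^sup>\<omega>)\<close>. Sets of vertices are stored in single cells as sums of powers of two.\<close>

section \<open>A program logic with a step counter\<close>

text \<open>Pruning is tested when a configuration is expanded, not when it is created. A
  configuration at a time \<open>t > 0\<close> thus inherits from its predecessor that every
  unvisited vertex has an arc with label at least \<open>t\<close>; once the path has left its
  start, every visited vertex has one with label at most \<open>t\<close>. These weak inequalities
  are the ones that define the VIM set, and they leave freedom on that set only. Pruning loses no
  solution, since a Hamiltonian path enters all unvisited vertices later. It also ends the search:
  no arc lies after the lifetime, so neither lifetime nor width is ever computed. Scanning the whole
  list of \<open>M \<le> n * n * \<Lambda>\<close> arcs for each configuration costs order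
  \<open>\<Lambda> ^ 2 * n ^ 3 * 2 ^ \<omega>\<close>, so the arcs need be neither sorted nor
  indexed. As the machine lacks multiplication and bit operations, powers of two arise by doubling,
  and sets are decoded by comparison and subtraction.\<close>

text \<open>The last argument \<open>\<tau>\<close> is a ghost clock: the postcondition sees the time elapsed so far,
  so that running times are bounded by ordinary loop invariants.\<close>

definition wp :: "com \<Rightarrow> ((reg \<Rightarrow> nat) \<Rightarrow> (nat \<Rightarrow> nat) \<Rightarrow> nat \<Rightarrow> bool) \<Rightarrow> (reg \<Rightarrow> nat) \<Rightarrow> (nat \<Rightarrow> nat) \<Rightarrow> nat \<Rightarrow> bool" where
  "wp c Q r m \<tau> \<longleftrightarrow> (\<exists>k r' m'. exec c (r, m) k (r', m') \<and> Q r' m' (\<tau> + k))"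

notation Seq (infixr ";;" 60)

lemma wp_Skip [simp]: "wp Skip Q r m \<tau> \<longleftrightarrow> Q r m (Suc \<tau>)"
  unfolding wp_def by (auto elim!: exec_SkipE intro!: exI exec.Skip)

lemma wp_Const [simp]: "wp (Const i a) Q r m \<tau> \<longleftrightarrow> Q (r(i := a)) m (Suc \<tau>)"
  unfolding wp_def by (auto elim!: exec_ConstE intro!: exI exec.Const)

lemma wp_Move [simp]: "wp (Move i j) Q r m \<tau> \<longleftrightarrow> Q (r(i := r j)) m (Suc \<tau>)"
  unfolding wp_def by (auto elim!: exec_MoveE intro!: exI exec.Move)

lemma wp_Add [simp]: "wp (Add i j k) Q r m \<tau> \<longleftrightarrow> Q (r(i := r j + r k)) m (Suc \<tau>)"
  unfolding wp_def by (auto elim!: exec_AddE intro!: exI exec.Add)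

lemma wp_Sub [simp]: "wp (Sub i j k) Q r m \<tau> \<longleftrightarrow> Q (r(i := r j - r k)) m (Suc \<tau>)"
  unfolding wp_def by (auto elim!: exec_SubE intro!: exI exec.Sub)

lemma wp_Load [simp]: "wp (Load i j) Q r m \<tau> \<longleftrightarrow> Q (r(i := m (r j))) m (Suc \<tau>)"
  unfolding wp_def by (auto elim!: exec_LoadE intro!: exI exec.Load)

lemma wp_Store [simp]: "wp (Store i j) Q r m \<tau> \<longleftrightarrow> Q r (m(r i := r j)) (Suc \<tau>)"
  unfolding wp_def by (auto elim!: exec_StoreE intro!: exI exec.Store)

lemma wp_Seq [simp]: "wp (c ;; d) Q r m \<tau> \<longleftrightarrow> wp c (wp d Q) r m \<tau>"
proof
  assume "wp (c ;; d) Q r m \<tau>"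
  then show "wp c (wp d Q) r m \<tau>"
    unfolding wp_def by (fastforce elim!: exec_SeqE simp: add.assoc)
next
  assume "wp c (wp d Q) r m \<tau>"
  then show "wp (c ;; d) Q r m \<tau>"
    unfolding wp_def by (metis add.assoc exec.Seq)
qed

text \<open>A test costs one step before control passes on; this rule covers both branches of a
  conditional and the entry into a loop body.\<close>

lemma wp_Suc:
  assumes "\<And>k s. exec c (r, m) k s \<longleftrightarrow> (\<exists>k'. k = Suc k' \<and> exec d (r, m) k' s)"
  shows "wp c Q r m \<tau> \<longleftrightarrow> wp d Q r m (Suc \<tau>)"
  unfolding wp_def assms by (metis add_Suc add_Suc_right)

lemma wp_Cond [simp]:
  "wp (Cond b c d) Q r m \<tau> \<longleftrightarrow> (if holds b r then wp c Q r m (Suc \<tau>) else wp d Q r m (Suc \<tau>))"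
proof (cases "holds b r")
  case True
  then have "wp (Cond b c d) Q r m \<tau> \<longleftrightarrow> wp c Q r m (Suc \<tau>)"
    by (intro wp_Suc) (auto elim!: exec_CondE intro: exec.CondTrue)
  with True show ?thesis by simp
next
  case False
  then have "wp (Cond b c d) Q r m \<tau> \<longleftrightarrow> wp d Q r m (Suc \<tau>)"
    by (intro wp_Suc) (auto elim!: exec_CondE intro: exec.CondFalse)
  with False show ?thesis by simp
qed

lemma wp_While:
  "wp (While b c) Q r m \<tau> \<longleftrightarrow>
     (if holds b r then wp c (wp (While b c) Q) r m (Suc \<tau>) else Q r m (Suc \<tau>))"
proof (cases "holds b r")
  case True
  have "exec (While b c) (r, m) k s \<longleftrightarrow> (\<exists>k'. k = Suc k' \<and> exec (c ;; While b c) (r, m) k' s)" for k s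
  proof
    assume "exec (While b c) (r, m) k s"
    then show "\<exists>k'. k = Suc k' \<and> exec (c ;; While b c) (r, m) k' s"
      by (rule exec_WhileE) (use True in \<open>auto intro: exec.Seq\<close>)
  next
    assume "\<exists>k'. k = Suc k' \<and> exec (c ;; While b c) (r, m) k' s"
    then obtain k' where k: "k = Suc k'" and e: "exec (c ;; While b c) (r, m) k' s" by blast
    from e show "exec (While b c) (r, m) k s"
      by (rule exec_SeqE) (use True k in \<open>auto intro: exec.WhileTrue\<close>)
  qed
  from wp_Suc[OF this] have "wp (While b c) Q r m \<tau> \<longleftrightarrow> wp (c ;; While b c) Q r m (Suc \<tau>)" .
  then show ?thesis using True by simp
next
  case False
  then have "exec (While b c) (r, m) k s \<longleftrightarrow> k = 1 \<and> s = (r, m)" for k s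
    using exec.WhileFalse[of b "(r, m)" c] by (metis exec_deterministic fst_conv)
  then show ?thesis using False unfolding wp_def by simp
qed

text \<open>\<open>wp\<close> asserts termination, hence the measure \<open>f\<close>; the running
  time is left to the invariant, which sees \<open>\<tau>\<close>. The rule serves the main search,
  whose list grows while it is processed. Loops over a fixed list or counter are unfolded by
  induction instead.\<close>

lemma wp_while_invariant:
  assumes "I r m \<tau>"
    and "\<And>r m \<tau>. I r m \<tau> \<Longrightarrow> holds b r \<Longrightarrow>
      wp c (\<lambda>r' m' \<tau>'. I r' m' \<tau>' \<and> (f r' m' :: nat) < f r m) r m (Suc \<tau>)"
    and "\<And>r m \<tau>. I r m \<tau> \<Longrightarrow> \<not> holds b r \<Longrightarrow> Q r m (Suc \<tau>)"
  shows "wp (While b c) Q r m \<tau>"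
  using assms(1)
proof (induction "f r m" arbitrary: r m \<tau> rule: less_induct)
  case less
  show ?case
  proof (cases "holds b r")
    case True
    have "wp c (wp (While b c) Q) r m (Suc \<tau>)"
      using assms(2)[OF less.prems True] less.hyps unfolding wp_def by blast
    then show ?thesis using True by (simp add: wp_While)
  next
    case False
    then show ?thesis using assms(3) less.prems by (simp add: wp_While)
  qed
qed

section \<open>Lists and lists of triples as contiguous memory blocks\<close>

definition seg :: "(nat \<Rightarrow> nat) \<Rightarrow> nat \<Rightarrow> nat list \<Rightarrow> bool" where
  "seg m p ys \<longleftrightarrow> (\<forall>i<length ys. m (p + i) = ys ! i)"

lemma seg_Nil [simp]: "seg m p []"
  by (simp add: seg_def)

lemma seg_Cons [simp]: "seg m p (y # ys) \<longleftrightarrow> m p = y \<and> seg m (Suc p) ys"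
  by (simp add: seg_def All_less_Suc2)

lemma seg_append [simp]: "seg m p (xs @ ys) \<longleftrightarrow> seg m p xs \<and> seg m (p + length xs) ys"
  by (induction xs arbitrary: p) auto

lemma seg_cong: "seg m p ys \<Longrightarrow> (\<And>a. p \<le> a \<Longrightarrow> a < p + length ys \<Longrightarrow> m' a = m a) \<Longrightarrow> seg m' p ys"
  by (simp add: seg_def)

lemma seg_update [simp]: "a < p \<or> p + length ys \<le> a \<Longrightarrow> seg (m(a := x)) p ys \<longleftrightarrow> seg m p ys"
  by (intro iffI; erule seg_cong) auto

fun flat :: "('a \<times> 'a \<times> 'a) list \<Rightarrow> 'a list" where
  "flat [] = []"
| "flat ((a, b, c) # xs) = a # b # c # flat xs"

lemma length_flat [simp]: "length (flat xs) = 3 * length xs"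
  by (induction xs rule: flat.induct) auto

lemma flat_append [simp]: "flat (xs @ ys) = flat xs @ flat ys"
  by (induction xs rule: flat.induct) auto

section \<open>Registers\<close>

text \<open>Subroutines only write registers above a threshold, which keeps their frame conditions
  short; 1 is avoided since the simplifier rewrites it to \<open>Suc 0\<close>.\<close>

abbreviation (input) "rRes \<equiv> 0 :: reg"
abbreviation (input) "rOne \<equiv> 2 :: reg"
abbreviation (input) "rZero \<equiv> 3 :: reg"
abbreviation (input) "rN \<equiv> 4 :: reg"
abbreviation (input) "rPw \<equiv> 5 :: reg"
abbreviation (input) "rMx \<equiv> 6 :: reg"
abbreviation (input) "rTr \<equiv> 7 :: reg"
abbreviation (input) "rVis \<equiv> 8 :: reg"
abbreviation (input) "rQb \<equiv> 9 :: reg"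
abbreviation (input) "rHp \<equiv> 10 :: reg"
abbreviation (input) "rT \<equiv> 11 :: reg"
abbreviation (input) "rS \<equiv> 12 :: reg"
abbreviation (input) "rV \<equiv> 13 :: reg"
abbreviation (input) "rT1 \<equiv> 14 :: reg"
abbreviation (input) "rGood \<equiv> 15 :: reg"
abbreviation (input) "rFull \<equiv> 16 :: reg"
abbreviation (input) "rSc \<equiv> 20 :: reg"
abbreviation (input) "rPs \<equiv> 21 :: reg"
abbreviation (input) "rPv \<equiv> 22 :: reg"
abbreviation (input) "rTp \<equiv> 30 :: reg"
abbreviation (input) "rX \<equiv> 31 :: reg"
abbreviation (input) "rA \<equiv> 32 :: reg"
abbreviation (input) "rB \<equiv> 33 :: reg"
abbreviation (input) "rC \<equiv> 34 :: reg"
abbreviation (input) "rFound \<equiv> 35 :: reg"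
abbreviation (input) "rD \<equiv> 36 :: reg"
abbreviation (input) "rR \<equiv> 37 :: reg"

definition next_cell :: "reg \<Rightarrow> reg \<Rightarrow> com" where
  "next_cell i p = (Load i p ;; Add p p rOne)"

definition put_cell :: "reg \<Rightarrow> reg \<Rightarrow> com" where
  "put_cell p i = (Store p i ;; Add p p rOne)"

lemma wp_next_cell [simp]:
  "r rOne = Suc 0 \<Longrightarrow> i \<noteq> rOne \<Longrightarrow> p \<noteq> i \<Longrightarrow>
    wp (next_cell i p) Q r m \<tau> \<longleftrightarrow> Q (r(i := m (r p), p := Suc (r p))) m (Suc (Suc \<tau>))"
  by (simp add: next_cell_def)

lemma wp_put_cell [simp]:
  "r rOne = Suc 0 \<Longrightarrow>
    wp (put_cell p i) Q r m \<tau> \<longleftrightarrow> Q (r(p := Suc (r p))) (m(r p := r i)) (Suc (Suc \<tau>))"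
  by (simp add: put_cell_def)

section \<open>Inserting a state into the queue\<close>

text \<open>There is no early exit: the loop runs to the end of the queue even after a hit, so a
  bound on its cost needs the queue length only.\<close>

definition search :: com where
  "search = While (Less rX rTp)
     (next_cell rA rX ;; next_cell rB rX ;; next_cell rC rX ;;
      Cond (Equal rA rT1) (Cond (Equal rB rPs) (Cond (Equal rC rPv) (Const rFound 1) Skip) Skip) Skip)"

definition push :: com where
  "push = (Const rFound 0 ;; Move rX rQb ;; search ;;
     Cond (Equal rFound rZero) (put_cell rTp rT1 ;; put_cell rTp rPs ;; put_cell rTp rPv) Skip)"

text \<open>Appending at the end leaves earlier positions unchanged, so the read position of the
  queue stays valid during insertions.\<close>

definition ins :: "'a \<Rightarrow> 'a list \<Rightarrow> 'a list" where
  "ins x xs = (if x \<in> set xs then xs else xs @ [x])"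

lemma wp_search:
  assumes "seg m (r rX) (flat ys)" "r rTp = r rX + 3 * length ys" "r rOne = 1"
    and "\<And>r' \<tau>'. (\<forall>x<31. r' x = r x) \<Longrightarrow>
      r' rFound = (if (r rT1, r rPs, r rPv) \<in> set ys then 1 else r rFound) \<Longrightarrow>
      \<tau>' \<le> \<tau> + 12 * length ys + 1 \<Longrightarrow> Q r' m \<tau>'"
  shows "wp search Q r m \<tau>"
  using assms
proof (induction ys arbitrary: r \<tau> rule: flat.induct)
  case 1
  then show ?case unfolding search_def by (subst wp_While) simp
next
  case (2 a b c ys)
  have step: "wp search Q r1 m \<tau>1"
    if "\<forall>x<31. r1 x = r x" "r1 rX = Suc (Suc (Suc (r rX)))" "\<tau>1 \<le> \<tau> + 11"
      "r1 rFound = (if (r rT1, r rPs, r rPv) = (a, b, c) then 1 else r rFound)" for r1 \<tau>1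
  proof (rule "2.IH")
    fix r' \<tau>'
    assume *: "\<forall>x<31. r' x = r1 x"
      "r' rFound = (if (r1 rT1, r1 rPs, r1 rPv) \<in> set ys then 1 else r1 rFound)"
      "\<tau>' \<le> \<tau>1 + 12 * length ys + 1"
    show "Q r' m \<tau>'"
      by (rule "2.prems"(4)) (use * that in simp_all)
  qed (use "2.prems"(1-3) that in simp_all)
  have "r rX < r rTp" "r rOne = Suc 0" "m (r rX) = a" "m (Suc (r rX)) = b" "m (Suc (Suc (r rX))) = c"
    using "2.prems"(1-3) by auto
  then show ?case
    unfolding search_def
    by (subst wp_While, fold search_def) (simp, intro conjI impI; rule step; simp)
qed

lemma wp_push:
  assumes "seg m (r rQb) (flat qs)" "r rTp = r rQb + 3 * length qs" "r rOne = 1" "r rZero = 0"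
    and "\<And>r' m' \<tau>'. (\<forall>x<30. r' x = r x) \<Longrightarrow> \<forall>a<r rQb. m' a = m a \<Longrightarrow>
      seg m' (r rQb) (flat (ins (r rT1, r rPs, r rPv) qs)) \<Longrightarrow>
      r' rTp = r rQb + 3 * length (ins (r rT1, r rPs, r rPv) qs) \<Longrightarrow>
      \<tau>' \<le> \<tau> + 12 * length qs + 12 \<Longrightarrow> Q r' m' \<tau>'"
  shows "wp push Q r m \<tau>"
proof -
  let ?k = "(r rT1, r rPs, r rPv)"
  show ?thesis
    unfolding push_def
    apply (simp only: wp_Seq wp_Const wp_Move)
    apply (rule wp_search[where ys = qs])
       apply (use assms(1-4) in simp)
      apply (use assms(1-4) in simp)
     apply (use assms(1-4) in simp)
    subgoal premises prems for r' \<tau>'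
    proof (cases "?k \<in> set qs")
      case True
      then have "r' rFound = 1" using prems(2) by simp
      then show ?thesis using prems True assms(1-4) by (auto intro!: assms(5) simp: ins_def)
    next
      case False
      then show ?thesis using prems assms(1-4) by (auto intro!: assms(5) simp: ins_def)
    qed
    done
qed

section \<open>Representing states of the search\<close>

text \<open>The arc relation will be symmetric, so an arc leaving \<open>u\<close> after time
  \<open>t\<close> is also a chance to enter \<open>u\<close> after time \<open>t\<close>.\<close>

definition alive :: "(nat \<times> nat \<times> nat) set \<Rightarrow> nat \<Rightarrow> nat \<Rightarrow> bool" where
  "alive E t u \<longleftrightarrow> (\<exists>w l. (u, w, l) \<in> E \<and> t < l)"

definition good :: "nat \<Rightarrow> (nat \<times> nat \<times> nat) set \<Rightarrow> nat \<Rightarrow> nat set \<Rightarrow> bool" where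
  "good n E t A \<longleftrightarrow> (\<forall>u<n. u \<notin> A \<longrightarrow> alive E t u)"

text \<open>The memory map: powers of two, latest label of each vertex, arcs, membership flags of
  the decoded set, queue. The queue comes last because it grows during the search. Latest labels are
  specified through \<open>alive\<close> instead of \<open>Max\<close>, so that the entry 0 is
  correct for a vertex without arcs.\<close>

definition layout :: "nat \<Rightarrow> (nat \<times> nat \<times> nat) list \<Rightarrow> (reg \<Rightarrow> nat) \<Rightarrow> (nat \<Rightarrow> nat) \<Rightarrow> bool" where
  "layout n trs r m \<longleftrightarrow> r rOne = 1 \<and> r rZero = 0 \<and> r rN = n \<and>
     r rMx = r rPw + n \<and> r rTr = r rMx + n \<and> r rVis = r rTr + 3 * length trs \<and> r rQb = r rVis + n \<and>
     (\<forall>j<n. m (r rPw + j) = 2 ^ j) \<and>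
     (\<forall>j<n. \<forall>t. t < m (r rMx + j) \<longleftrightarrow> alive (set trs) t j) \<and>
     seg m (r rTr) (flat trs)"

lemma layout_cong:
  assumes "layout n trs r m" "\<forall>x. 2 \<le> x \<and> x < 10 \<longrightarrow> r' x = r x" "\<forall>a<r rVis. m' a = m a"
  shows "layout n trs r' m'"
  using assms by (auto simp: layout_def intro: seg_cong)

lemma layoutD:
  assumes "layout n trs r m"
  shows "r rOne = Suc 0" "r rZero = 0" "r rN = n" "r rMx = r rPw + n" "r rTr = r rMx + n"
    "r rVis = r rTr + 3 * length trs" "r rQb = r rVis + n"
    "j < n \<Longrightarrow> m (r rPw + j) = 2 ^ j"
    "j < n \<Longrightarrow> t < m (r rMx + j) \<longleftrightarrow> alive (set trs) t j"
    "seg m (r rTr) (flat trs)"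
  using assms unfolding layout_def One_nat_def by blast+

type_synonym config = "nat \<times> nat set \<times> nat"

definition code :: "config \<Rightarrow> nat \<times> nat \<times> nat" where
  "code = (\<lambda>(t, A, v). (t, set_encode A, v))"

definition queue :: "config list \<Rightarrow> (reg \<Rightarrow> nat) \<Rightarrow> (nat \<Rightarrow> nat) \<Rightarrow> bool" where
  "queue qs r m \<longleftrightarrow> seg m (r rQb) (flat (map code qs)) \<and> r rTp = r rQb + 3 * length qs \<and>
     (\<forall>(t, A, v) \<in> set qs. finite A)"

text \<open>\<open>set_encode\<close> is injective on finite sets only, which is why
  \<open>queue\<close> demands finiteness; comparing codes then decides equality of sets.\<close>

lemma map_code_ins:
  assumes "\<forall>(t, A, v) \<in> set qs. finite A" "finite A"
  shows "map code (ins (t, A, v) qs) = ins (t, set_encode A, v) (map code qs)"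
proof -
  have "(t, set_encode A, v) \<in> set (map code qs) \<longleftrightarrow> (t, A, v) \<in> set qs"
    using assms by (force simp: code_def set_encode_eq)
  then show ?thesis by (simp add: ins_def code_def)
qed

lemma set_ins [simp]: "set (ins x xs) = insert x (set xs)"
  by (auto simp: ins_def)

lemma distinct_ins [simp]: "distinct (ins x xs) \<longleftrightarrow> distinct xs"
  by (simp add: ins_def)

lemma length_ins_le: "length xs \<le> length (ins x xs)"
  by (simp add: ins_def)

lemma wp_push_config:
  assumes "queue qs r m" "r rOne = 1" "r rZero = 0" "r rT1 = t" "r rPs = set_encode A" "r rPv = v" "finite A"
    and "\<And>r' m' \<tau>'. (\<forall>x<30. r' x = r x) \<Longrightarrow> \<forall>a<r rQb. m' a = m a \<Longrightarrow>
      queue (ins (t, A, v) qs) r' m' \<Longrightarrow> \<tau>' \<le> \<tau> + 12 * length qs + 12 \<Longrightarrow> Q r' m' \<tau>'"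
  shows "wp push Q r m \<tau>"
proof (rule wp_push[where qs = "map code qs"])
  fix r' m' \<tau>'
  assume *: "\<forall>x<30. r' x = r x" "\<forall>a<r rQb. m' a = m a"
    "seg m' (r rQb) (flat (ins (r rT1, r rPs, r rPv) (map code qs)))"
    "r' rTp = r rQb + 3 * length (ins (r rT1, r rPs, r rPv) (map code qs))"
    "\<tau>' \<le> \<tau> + 12 * length (map code qs) + 12"
  have fin: "\<forall>(t, A, v) \<in> set qs. finite A" using assms(1) by (simp add: queue_def)
  have "ins (r rT1, r rPs, r rPv) (map code qs) = map code (ins (t, A, v) qs)"
    using map_code_ins[OF fin assms(7)] assms(4-6) by simp
  moreover have "length (map code (ins (t, A, v) qs)) = length (ins (t, A, v) qs)"
    by simp
  ultimately have "queue (ins (t, A, v) qs) r' m'"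
    using * fin assms(7) unfolding queue_def by simp
  then show "Q r' m' \<tau>'" using * assms(8) by simp
qed (use assms in \<open>simp_all add: queue_def\<close>)

section \<open>Decoding a state\<close>

text \<open>Binary digits are extracted from the top: \<open>d\<close> belongs to the set iff the
  remainder is at least \<open>2 ^ d\<close>. The same pass evaluates both tests: an absent vertex
  clears \<open>rFull\<close>, and also \<open>rGood\<close> if its latest label does not exceed the
  current time.\<close>

definition decode_loop :: com where
  "decode_loop = While (Less rZero rD)
     (Sub rD rD rOne ;; Add rX rPw rD ;; Load rB rX ;; Add rA rVis rD ;;
      Cond (Less rR rB)
        (Const rFull 0 ;; Store rA rZero ;; Add rX rMx rD ;; Load rB rX ;;
         Cond (Less rT rB) Skip (Const rGood 0))
        (Sub rR rR rB ;; Store rA rOne))"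

definition decode :: com where
  "decode = (Const rFull 1 ;; Const rGood 1 ;; Move rD rN ;; Move rR rS ;; decode_loop)"

lemma set_encode_lessThan_Suc:
  "set_encode (A \<inter> {..<Suc d}) = (if d \<in> A then 2 ^ d else 0) + set_encode (A \<inter> {..<d})"
proof (cases "d \<in> A")
  case True
  then have "A \<inter> {..<Suc d} = insert d (A \<inter> {..<d})" by auto
  then show ?thesis using True by simp
next
  case False
  then have "A \<inter> {..<Suc d} = A \<inter> {..<d}" using less_Suc_eq by auto
  then show ?thesis using False by simp
qed

text \<open>This justifies the greedy decoding: the lower digits together cannot imitate the digit
  \<open>d\<close>.\<close>

lemma set_encode_less_power: "set_encode (A \<inter> {..<d}) < 2 ^ d"
  by (induction d) (auto simp: set_encode_lessThan_Suc)

lemma wp_decode_loop: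
  assumes "r rD = d" "r rOne = 1" "r rZero = 0" "\<forall>j<d. m (r rPw + j) = 2 ^ j"
    "\<forall>j<d. r rT < m (r rMx + j) \<longleftrightarrow> al j" "r rPw + d \<le> r rVis" "r rMx + d \<le> r rVis"
    "r rR = set_encode (A \<inter> {..<d})"
    and "\<And>r' m' \<tau>'. (\<forall>x<31. x \<noteq> rGood \<longrightarrow> x \<noteq> rFull \<longrightarrow> r' x = r x) \<Longrightarrow>
      (\<forall>a. a < r rVis \<or> r rVis + d \<le> a \<longrightarrow> m' a = m a) \<Longrightarrow>
      (\<forall>j<d. m' (r rVis + j) = of_bool (j \<in> A)) \<Longrightarrow>
      r' rFull = (if \<forall>j<d. j \<in> A then r rFull else 0) \<Longrightarrow>
      r' rGood = (if \<forall>j<d. j \<notin> A \<longrightarrow> al j then r rGood else 0) \<Longrightarrow>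
      \<tau>' \<le> \<tau> + 12 * d + 1 \<Longrightarrow> Q r' m' \<tau>'"
  shows "wp decode_loop Q r m \<tau>"
  using assms
proof (induction d arbitrary: r m \<tau>)
  case 0
  then show ?case unfolding decode_loop_def by (subst wp_While) simp
next
  case (Suc d)
  have step: "wp decode_loop Q r1 m1 \<tau>1"
    if "r1 rD = d" "\<forall>x<31. x \<noteq> rGood \<longrightarrow> x \<noteq> rFull \<longrightarrow> r1 x = r x"
      "r1 rFull = (if d \<in> A then r rFull else 0)"
      "r1 rGood = (if d \<notin> A \<longrightarrow> al d then r rGood else 0)"
      "r1 rR = set_encode (A \<inter> {..<d})" "m1 = m(r rVis + d := of_bool (d \<in> A))" "\<tau>1 \<le> \<tau> + 12"
    for r1 m1 \<tau>1
  proof (rule Suc.IH)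
    fix r' m' \<tau>'
    assume *: "\<forall>x<31. x \<noteq> rGood \<longrightarrow> x \<noteq> rFull \<longrightarrow> r' x = r1 x"
      "\<forall>a. a < r1 rVis \<or> r1 rVis + d \<le> a \<longrightarrow> m' a = m1 a"
      "\<forall>j<d. m' (r1 rVis + j) = of_bool (j \<in> A)"
      "r' rFull = (if \<forall>j<d. j \<in> A then r1 rFull else 0)"
      "r' rGood = (if \<forall>j<d. j \<notin> A \<longrightarrow> al j then r1 rGood else 0)"
      "\<tau>' \<le> \<tau>1 + 12 * d + 1"
    show "Q r' m' \<tau>'"
      by (rule Suc.prems(9)) (use * that in \<open>auto simp: less_Suc_eq\<close>)
  qed (use Suc.prems(1-8) that in \<open>auto\<close>)
  have R: "r rR = (if d \<in> A then 2 ^ d else 0) + set_encode (A \<inter> {..<d})"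
    using Suc.prems(8) by (simp add: set_encode_lessThan_Suc)
  have cmp: "r rR < 2 ^ d \<longleftrightarrow> d \<notin> A" "d \<in> A \<Longrightarrow> r rR - 2 ^ d = set_encode (A \<inter> {..<d})"
    using R set_encode_less_power[of A d] by auto
  have "r rD = Suc d" "r rOne = Suc 0" "r rZero = 0" "m (r rPw + d) = 2 ^ d"
     "r rT < m (r rMx + d) \<longleftrightarrow> al d" "r rMx + d \<noteq> r rVis + d"
    using Suc.prems(1-7) by auto
  then show ?case
    unfolding decode_loop_def
    by (subst wp_While, fold decode_loop_def) (simp add: cmp, intro conjI impI; rule step; simp add: cmp R)
qed

lemma wp_decode:
  assumes "layout n trs r m" "r rS = set_encode A" "A \<subseteq> {..<n}"
    and "\<And>r' m' \<tau>'. (\<forall>x<31. x \<noteq> rGood \<longrightarrow> x \<noteq> rFull \<longrightarrow> r' x = r x) \<Longrightarrow>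
      (\<forall>a. a < r rVis \<or> r rQb \<le> a \<longrightarrow> m' a = m a) \<Longrightarrow>
      (\<forall>j<n. m' (r rVis + j) = of_bool (j \<in> A)) \<Longrightarrow>
      r' rFull = of_bool (A = {..<n}) \<Longrightarrow> r' rGood = of_bool (good n (set trs) (r rT) A) \<Longrightarrow>
      \<tau>' \<le> \<tau> + 12 * n + 5 \<Longrightarrow> Q r' m' \<tau>'"
  shows "wp decode Q r m \<tau>"
  unfolding decode_def
  apply (simp only: wp_Seq wp_Const wp_Move)
  apply (rule wp_decode_loop[where d = n and A = A and al = "alive (set trs) (r rT)"])
  using layoutD[OF assms(1)] assms(2) Int_absorb2[OF assms(3)] apply simp_all[8]
  subgoal for r' m' \<tau>'
    apply (rule assms(4))
    using layoutD[OF assms(1)] assms(3)  by (auto simp: good_def)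
  done

section \<open>Expanding a state\<close>

definition scan :: com where
  "scan = While (Less rSc rVis)
     (next_cell rA rSc ;; next_cell rB rSc ;; next_cell rC rSc ;;
      Cond (Equal rA rV)
        (Cond (Equal rC rT1)
           (Add rX rVis rB ;; Load rD rX ;;
            Cond (Equal rD rZero)
              (Add rX rPw rB ;; Load rD rX ;; Add rPs rS rD ;; Move rPv rB ;; push)
              Skip)
           Skip)
        Skip)"

text \<open>Mirrors one round of \<open>scan\<close> on lists, including the order of insertion, so
  that the queue in memory is described exactly and not merely as a set.\<close>

definition arc_step :: "nat \<Rightarrow> nat \<Rightarrow> nat set \<Rightarrow> nat \<times> nat \<times> nat \<Rightarrow> config list \<Rightarrow> config list" where
  "arc_step t v A = (\<lambda>(a, b, l) qs. if a = v \<and> l = t \<and> b \<notin> A then ins (t, insert b A, b) qs else qs)"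

lemma set_fold_arc_step:
  "set (fold (arc_step t v A) ys qs) =
    set qs \<union> {(t, insert b A, b) |b. (v, b, t) \<in> set ys \<and> b \<notin> A}"
  by (induction ys arbitrary: qs) (auto simp: arc_step_def split: if_splits)

lemma arc_step_append: "\<exists>zs. arc_step t v A y qs = qs @ zs"
  by (cases y) (simp add: arc_step_def ins_def)

lemma fold_arc_step_append: "\<exists>zs. fold (arc_step t v A) ys qs = qs @ zs"
proof (induction ys arbitrary: qs)
  case (Cons y ys)
  obtain zs where "arc_step t v A y qs = qs @ zs"
    using arc_step_append by blast
  moreover obtain zs' where "fold (arc_step t v A) ys (qs @ zs) = (qs @ zs) @ zs'"
    using Cons.IH by blast
  ultimately show ?case by simp
qed simp

lemma length_fold_arc_step: "length qs \<le> length (fold (arc_step t v A) ys qs)"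
  using fold_arc_step_append[of t v A ys qs] by auto

lemma distinct_arc_step: "distinct qs \<Longrightarrow> distinct (arc_step t v A y qs)"
  by (cases y) (simp add: arc_step_def)

lemma distinct_fold_arc_step: "distinct qs \<Longrightarrow> distinct (fold (arc_step t v A) ys qs)"
  by (induction ys arbitrary: qs) (simp_all add: distinct_arc_step)

abbreviation out_arcs :: "nat \<Rightarrow> nat \<Rightarrow> (nat \<times> nat \<times> nat) list \<Rightarrow> (nat \<times> nat \<times> nat) list" where
  "out_arcs t v ys \<equiv> filter (\<lambda>(a, b, l). a = v \<and> l = t) ys"

lemma queue_cong: "queue qs r m \<Longrightarrow> r' rQb = r rQb \<Longrightarrow> r' rTp = r rTp \<Longrightarrow> \<forall>a\<ge>r rQb. m' a = m a \<Longrightarrow> queue qs r' m'"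
  unfolding queue_def by (auto intro: seg_cong)

text \<open>The queue never shrinks, so its final length \<open>K\<close> bounds every search made
  on the way, at a cost of \<open>12 * K + 12\<close> each. Only arcs that leave the current vertex
  at the right time are charged for a search; all others cost a constant.\<close>

lemma wp_scan:
  assumes "layout n trs r m" "seg m (r rSc) (flat ys)" "r rVis = r rSc + 3 * length ys"
    "\<forall>(a, b, l)\<in>set ys. b < n" "\<forall>j<n. m (r rVis + j) = of_bool (j \<in> A)" "finite A"
    "r rS = set_encode A" "queue qs r m"
    "length (fold (arc_step (r rT1) (r rV) A) ys qs) \<le> K"
    and "\<And>r' m' \<tau>'. (\<forall>x<20. r' x = r x) \<Longrightarrow> (\<forall>a<r rQb. m' a = m a) \<Longrightarrow>
      queue (fold (arc_step (r rT1) (r rV) A) ys qs) r' m' \<Longrightarrow>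
      \<tau>' \<le> \<tau> + 16 * length ys + 1 + length (out_arcs (r rT1) (r rV) ys) * (12 * K + 12) \<Longrightarrow> Q r' m' \<tau>'"
  shows "wp scan Q r m \<tau>"
  using assms
proof (induction ys arbitrary: r m qs \<tau> rule: flat.induct)
  case 1
  then show ?case unfolding scan_def by (subst wp_While) simp
next
  case (2 a b c ys)
  let ?hit = "a = r rV \<and> c = r rT1"
  let ?qs = "arc_step (r rT1) (r rV) A (a, b, c) qs"
  have step: "wp scan Q r1 m1 \<tau>1"
    if "\<forall>x<20. r1 x = r x" "r1 rSc = Suc (Suc (Suc (r rSc)))" "\<forall>a<r rQb. m1 a = m a"
      "queue ?qs r1 m1" "\<tau>1 \<le> \<tau> + 16 + (if ?hit then 12 * K + 12 else 0)" for r1 m1 \<tau>1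
  proof (rule "2.IH")
    show "layout n trs r1 m1"
      by (rule layout_cong[OF "2.prems"(1)]) (use that layoutD(7)[OF "2.prems"(1)] in auto)
    show "seg m1 (r1 rSc) (flat ys)"
      using "2.prems"(2,3) that(1-3) layoutD(7)[OF "2.prems"(1)] by (auto intro: seg_cong)
    show "queue ?qs r1 m1" by fact
    show "length (fold (arc_step (r1 rT1) (r1 rV) A) ys ?qs) \<le> K"
      using that(1) "2.prems"(9) by simp
    fix r' m' \<tau>'
    assume *: "\<forall>x<20. r' x = r1 x" "\<forall>a<r1 rQb. m' a = m1 a"
      "queue (fold (arc_step (r1 rT1) (r1 rV) A) ys ?qs) r' m'"
      "\<tau>' \<le> \<tau>1 + 16 * length ys + 1 + length (out_arcs (r1 rT1) (r1 rV) ys) * (12 * K + 12)"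
    show "Q r' m' \<tau>'"
      by (rule "2.prems"(10)) (use * that in \<open>auto split: if_splits\<close>)
  qed (use "2.prems"(3-7) that layoutD(7)[OF "2.prems"(1)] in auto)
  have fetch: "r rSc < r rVis" "r rOne = Suc 0" "m (r rSc) = a" "m (Suc (r rSc)) = b" "m (Suc (Suc (r rSc))) = c"
      "r rZero = 0"
    using "2.prems"(2,3) layoutD(1,2)[OF "2.prems"(1)] by auto
  have arrays: "m (r rVis + b) = of_bool (b \<in> A)" "m (r rPw + b) = 2 ^ b"
    using "2.prems"(4,5) layoutD(8)[OF "2.prems"(1)] by auto
  have K: "length qs \<le> K"
    using "2.prems"(9) length_fold_arc_step[of ?qs "r rT1" "r rV" A ys] length_ins_le[of qs "(c, insert b A, b)"]
    by (auto simp: arc_step_def split: if_splits)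
  have pushing: "wp push (wp scan Q) r1 m \<tau>1"
    if "?hit" "b \<notin> A" "\<forall>x<20. r1 x = r x" "r1 rSc = Suc (Suc (Suc (r rSc)))" "r1 rTp = r rTp"
      "r1 rPs = set_encode (insert b A)" "r1 rPv = b" "\<tau>1 \<le> \<tau> + 16" for r1 \<tau>1
  proof (rule wp_push_config[where A = "insert b A"])
    show "queue qs r1 m"
      by (rule queue_cong[OF "2.prems"(8)]) (use that in auto)
    fix r' m' \<tau>'
    assume *: "\<forall>x<30. r' x = r1 x" "\<forall>a<r1 rQb. m' a = m a"
      "queue (ins (r rT1, insert b A, b) qs) r' m'" "\<tau>' \<le> \<tau>1 + 12 * length qs + 12"
    show "wp scan Q r' m' \<tau>'"
      by (rule step) (use * that K in \<open>simp_all add: arc_step_def\<close>)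
  qed (use that fetch "2.prems"(6) in simp_all)
  have skip: "wp scan Q r1 m \<tau>1"
    if "\<forall>x<20. r1 x = r x" "r1 rSc = Suc (Suc (Suc (r rSc)))" "r1 rTp = r rTp" "\<not> (?hit \<and> b \<notin> A)"
      "\<tau>1 \<le> \<tau> + 16" for r1 \<tau>1
    by (rule step) (use that queue_cong[OF "2.prems"(8), of r1 m] in \<open>auto simp: arc_step_def\<close>)
  show ?case
    unfolding scan_def
    apply (subst wp_While, fold scan_def)
    apply (simp add: fetch arrays)
    apply (intro conjI impI)
       apply (rule pushing; simp add: "2.prems"(6,7))
    apply (rule skip; simp)+
    done
qed

definition expand :: "(nat \<times> nat \<times> nat) list \<Rightarrow> config \<Rightarrow> config list \<Rightarrow> config list" where
  "expand trs = (\<lambda>(t, A, v) qs. fold (arc_step (Suc t) v A) trs (ins (Suc t, A, v) qs))"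

definition expand_com :: com where
  "expand_com = (Move rPs rS ;; Move rPv rV ;; push ;; Move rSc rTr ;; scan)"

text \<open>With tail and label fixed, an arc is determined by its head, so a duplicate-free list
  has at most one such arc per vertex.\<close>

lemma length_out_arcs:
  assumes "distinct ys" "\<forall>(a, b, l)\<in>set ys. b < n"
  shows "length (out_arcs t v ys) \<le> n"
proof -
  have "length (out_arcs t v ys) = card (set (out_arcs t v ys))"
    by (rule distinct_card[symmetric]) (use assms(1) in simp)
  also have "\<dots> \<le> card ((\<lambda>b. (v, b, t)) ` {..<n})"
    using assms(2) by (intro card_mono) auto
  also have "\<dots> \<le> n"
    using card_image_le[of "{..<n}" "\<lambda>b. (v, b, t)"] by simp
  finally show ?thesis .
qed

lemma wp_expand:
  assumes "layout n trs r m" "distinct trs" "\<forall>(a, b, l)\<in>set trs. b < n"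
    "\<forall>j<n. m (r rVis + j) = of_bool (j \<in> A)" "finite A"
    "r rS = set_encode A" "r rV = v" "r rT1 = Suc t" "queue qs r m"
    "length (expand trs (t, A, v) qs) \<le> K"
    and "\<And>r' m' \<tau>'. (\<forall>x<20. r' x = r x) \<Longrightarrow> (\<forall>a<r rQb. m' a = m a) \<Longrightarrow>
      queue (expand trs (t, A, v) qs) r' m' \<Longrightarrow>
      \<tau>' \<le> \<tau> + 16 * length trs + 4 + (n + 1) * (12 * K + 12) \<Longrightarrow> Q r' m' \<tau>'"
  shows "wp expand_com Q r m \<tau>"
proof -
  have K: "length qs \<le> K"
    using assms(10) length_fold_arc_step[of "ins (Suc t, A, v) qs" "Suc t" v A trs]
      length_ins_le[of qs "(Suc t, A, v)"]
    by (simp add: expand_def)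
  have "length (out_arcs (Suc t) v trs) * (12 * K + 12) \<le> n * (12 * K + 12)"
    using length_out_arcs[OF assms(2,3)] by (rule mult_right_mono) simp
  \<comment> \<open>The additional summand pays for inserting the waiting configuration.\<close>
  then have hits: "length (out_arcs (Suc t) v trs) * (12 * K + 12) + (12 * K + 12) \<le> (n + 1) * (12 * K + 12)"
    by (simp add: algebra_simps)
  have scanning: "wp scan Q r2 m2 \<tau>2"
    if "\<forall>x<20. r2 x = r x" "r2 rSc = r rTr" "\<forall>a<r rQb. m2 a = m a"
      "queue (ins (Suc t, A, v) qs) r2 m2" "\<tau>2 \<le> \<tau> + 3 + (12 * K + 12)" for r2 m2 \<tau>2
  proof (rule wp_scan[where ys = trs and A = A and K = K])
    show layout: "layout n trs r2 m2"
      by (rule layout_cong[OF assms(1)]) (use that layoutD(7)[OF assms(1)] in auto)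
    show "seg m2 (r2 rSc) (flat trs)" "r2 rVis = r2 rSc + 3 * length trs"
      using layoutD(6,10)[OF layout] that(1,2) by simp_all
    show "queue (ins (Suc t, A, v) qs) r2 m2" by fact
    fix r' m' \<tau>'
    assume *: "\<forall>x<20. r' x = r2 x" "\<forall>a<r2 rQb. m' a = m2 a"
      "queue (fold (arc_step (r2 rT1) (r2 rV) A) trs (ins (Suc t, A, v) qs)) r' m'"
      "\<tau>' \<le> \<tau>2 + 16 * length trs + 1 + length (out_arcs (r2 rT1) (r2 rV) trs) * (12 * K + 12)"
    have arcs: "r2 rT1 = Suc t" "r2 rV = v" using that(1) assms(7,8) by simp_all
    have "\<tau>' \<le> \<tau> + 16 * length trs + 4 + (n + 1) * (12 * K + 12)"
      using *(4)[unfolded arcs] that(5) hits by linarith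
    then show "Q r' m' \<tau>'"
      by (intro assms(11)) (use * that assms(7,8) in \<open>simp_all add: expand_def\<close>)
  qed (use assms that layoutD(7)[OF assms(1)] in \<open>auto simp: expand_def\<close>)
  show ?thesis
    unfolding expand_com_def
    apply (simp only: wp_Seq wp_Move)
    apply (rule wp_push_config[where A = A and qs = qs and v = v and t = "Suc t"])
           apply (rule queue_cong[OF assms(9)])
    using assms(5-8) layoutD(1,2)[OF assms(1)]
    apply simp_all
    apply (rule scanning)
        apply (use K in \<open>auto intro: queue_cong\<close>)
    done
qed

section \<open>Exploring all reachable states\<close>

text \<open>A configuration \<open>(t, A, v)\<close> stands for a temporal path using labels at most \<open>t\<close>, visiting
  exactly \<open>A\<close> and ending in \<open>v\<close>. Configurations that are not \<open>good\<close> miss a vertex that can no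
  longer be entered and are not expanded; this is what keeps their number small.\<close>

inductive_set reach :: "nat \<Rightarrow> (nat \<times> nat \<times> nat) set \<Rightarrow> config set" for n E where
  start: "v < n \<Longrightarrow> (0, {v}, v) \<in> reach n E"
| wait: "(t, A, v) \<in> reach n E \<Longrightarrow> A \<noteq> {..<n} \<Longrightarrow> good n E t A \<Longrightarrow> (Suc t, A, v) \<in> reach n E"
| move: "(t, A, v) \<in> reach n E \<Longrightarrow> A \<noteq> {..<n} \<Longrightarrow> good n E t A \<Longrightarrow> (v, w, Suc t) \<in> E \<Longrightarrow> w \<notin> A \<Longrightarrow>
    (Suc t, insert w A, w) \<in> reach n E"

text \<open>\<open>good\<close> is vacuous for the full set. The test
  \<open>A \<noteq> {..<n}\<close> is what keeps a complete path from waiting forever and the search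
  from running on.\<close>

definition succs :: "nat \<Rightarrow> (nat \<times> nat \<times> nat) set \<Rightarrow> config \<Rightarrow> config set" where
  "succs n E = (\<lambda>(t, A, v). if A \<noteq> {..<n} \<and> good n E t A
     then insert (Suc t, A, v) {(Suc t, insert w A, w) |w. (v, w, Suc t) \<in> E \<and> w \<notin> A} else {})"

lemma succs_reach: "x \<in> reach n E \<Longrightarrow> succs n E x \<subseteq> reach n E"
  by (cases x) (auto simp: succs_def intro: reach.intros)

text \<open>Meant for the final queue: it contains the start configurations and is closed under
  successors, so nothing reachable is missing from it.\<close>

lemma reach_least:
  assumes "\<And>v. v < n \<Longrightarrow> (0, {v}, v) \<in> X" "\<And>x. x \<in> X \<Longrightarrow> succs n E x \<subseteq> X"
  shows "reach n E \<subseteq> X"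
proof -
  have "(t, A, v) \<in> X" if "(t, A, v) \<in> reach n E" for t A v
    using that
  proof induction
    case (wait t A v)
    then show ?case using assms(2)[of "(t, A, v)"] by (auto simp: succs_def)
  next
    case (move t A v w)
    then show ?case using assms(2)[of "(t, A, v)"] by (auto simp: succs_def)
  qed (use assms(1) in simp)
  then show ?thesis by auto
qed

lemma reach_subset:
  assumes "(t, A, v) \<in> reach n E" "\<forall>(a, b, l) \<in> E. b < n"
  shows "A \<subseteq> {..<n}"
  using assms(1) by induction (use assms(2) in auto)

text \<open>Finding the full set only raises the result flag, which is never lowered; the loop still
  empties the queue, so one time bound covers both answers.\<close>

definition body :: com where
  "body = (next_cell rT rHp ;; next_cell rS rHp ;; next_cell rV rHp ;; Add rT1 rT rOne ;; decode ;;
     Cond (Equal rFull rOne) (Const rRes 1) (Cond (Equal rGood rOne) expand_com Skip))"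

definition explore :: com where
  "explore = While (Less rHp rTp) body"

definition process :: "nat \<Rightarrow> (nat \<times> nat \<times> nat) list \<Rightarrow> config \<Rightarrow> config list \<Rightarrow> config list" where
  "process n trs = (\<lambda>(t, A, v) qs. if A \<noteq> {..<n} \<and> good n (set trs) t A then expand trs (t, A, v) qs else qs)"

lemma set_process: "set (process n trs x qs) = set qs \<union> succs n (set trs) x"
  by (cases x) (auto simp: process_def expand_def succs_def set_fold_arc_step)

lemma distinct_process: "distinct qs \<Longrightarrow> distinct (process n trs x qs)"
  by (cases x) (simp add: process_def expand_def distinct_fold_arc_step)

text \<open>Hence the processed prefix of the queue is never disturbed, on which the invariant of
  the main loop relies.\<close>

lemma process_append: "\<exists>zs. process n trs x qs = qs @ zs"
proof (cases x)
  case (fields t A v)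
  obtain zs where zs: "fold (arc_step (Suc t) v A) trs (ins (Suc t, A, v) qs) = ins (Suc t, A, v) qs @ zs"
    using fold_arc_step_append by blast
  show ?thesis
    using zs by (auto simp: process_def expand_def fields ins_def)
qed

lemma flat_nth:
  assumes "seg m p (flat xs)" "i < length xs" "xs ! i = (a, b, c)"
  shows "m (p + 3 * i) = a" "m (Suc (p + 3 * i)) = b" "m (Suc (Suc (p + 3 * i))) = c"
proof -
  have "flat xs = flat (take i xs) @ a # b # c # flat (drop (Suc i) xs)"
    using assms(2,3) by (metis flat.simps(2) flat_append id_take_nth_drop)
  then have "seg m (p + 3 * i) (a # b # c # flat (drop (Suc i) xs))"
    using assms(1,2) by (simp add: min_def)
  then show "m (p + 3 * i) = a" "m (Suc (p + 3 * i)) = b" "m (Suc (Suc (p + 3 * i))) = c"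
    by simp_all
qed

lemma wp_body:
  assumes "layout n trs r m" "distinct trs" "\<forall>(a, b, l)\<in>set trs. b < n"
    "queue qs r m" "h < length qs" "qs ! h = (t, A, v)" "A \<subseteq> {..<n}" "r rHp = r rQb + 3 * h"
    "length (process n trs (t, A, v) qs) \<le> K"
    and "\<And>r' m' \<tau>'. (\<forall>x. 2 \<le> x \<and> x < 10 \<longrightarrow> r' x = r x) \<Longrightarrow> r' rRes = (if A = {..<n} then 1 else r rRes) \<Longrightarrow>
      r' rHp = r rQb + 3 * Suc h \<Longrightarrow> (\<forall>a<r rVis. m' a = m a) \<Longrightarrow> queue (process n trs (t, A, v) qs) r' m' \<Longrightarrow>
      \<tau>' \<le> \<tau> + 12 * n + 16 * length trs + (n + 1) * (12 * K + 12) + 18 \<Longrightarrow> Q r' m' \<tau>'"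
  shows "wp body Q r m \<tau>"
proof -
  note L = layoutD[OF assms(1)]
  have fin: "finite A" using assms(7) finite_subset by blast
  have cells: "m (r rHp) = t" "m (Suc (r rHp)) = set_encode A" "m (Suc (Suc (r rHp))) = v"
  proof -
    have "seg m (r rQb) (flat (map code qs))" using assms(4) by (simp add: queue_def)
    from flat_nth[OF this, of h t "set_encode A" v] assms(5,6,8)
    show "m (r rHp) = t" "m (Suc (r rHp)) = set_encode A" "m (Suc (Suc (r rHp))) = v"
      by (simp_all add: code_def)
  qed
  have decoding: "wp decode (wp (Cond (Equal rFull rOne) (Const rRes (Suc 0)) (Cond (Equal rGood rOne) expand_com Skip)) Q) r1 m \<tau>1"
    if r1: "\<forall>x<10. r1 x = r x" "r1 rHp = r rQb + 3 * Suc h" "r1 rT = t" "r1 rS = set_encode A" "r1 rV = v"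
      "r1 rT1 = Suc t" "r1 rTp = r rTp" and \<tau>1: "\<tau>1 \<le> \<tau> + 7" for r1 \<tau>1
  proof (rule wp_decode[where A = A])
    show layout1: "layout n trs r1 m"
      by (rule layout_cong[OF assms(1)]) (use r1 in auto)
    show "r1 rS = set_encode A" "A \<subseteq> {..<n}" by fact+
    fix r2 m2 \<tau>2
    assume r2: "\<forall>x<31. x \<noteq> rGood \<longrightarrow> x \<noteq> rFull \<longrightarrow> r2 x = r1 x"
      and m2: "\<forall>a. a < r1 rVis \<or> r1 rQb \<le> a \<longrightarrow> m2 a = m a" "\<forall>j<n. m2 (r1 rVis + j) = of_bool (j \<in> A)"
      and flags: "r2 rFull = of_bool (A = {..<n})" "r2 rGood = of_bool (good n (set trs) (r1 rT) A)"
      and \<tau>2: "\<tau>2 \<le> \<tau>1 + 12 * n + 5"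
    have layout2: "layout n trs r2 m2"
      by (rule layout_cong[OF layout1]) (use r2 m2 in auto)
    have queue2: "queue qs r2 m2"
      by (rule queue_cong[OF assms(4)]) (use r1 r2 m2 in auto)
    show "wp (Cond (Equal rFull rOne) (Const rRes (Suc 0)) (Cond (Equal rGood rOne) expand_com Skip)) Q r2 m2 \<tau>2"
    proof (cases "A = {..<n}")
      case True
      then have "queue (process n trs (t, A, v) qs) (r2(0 := 1)) m2"
        using queue2 by (simp add: process_def queue_def)
      then have "Q (r2(0 := 1)) m2 (Suc (Suc \<tau>2))"
        by (intro assms(10)) (use True r1 r2 m2 \<tau>1 \<tau>2 in simp_all)
      then show ?thesis using True flags r2 r1 L by simp
    next
      case nonfull: False
      show ?thesis
      proof (cases "good n (set trs) t A")
        case True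
        have "wp expand_com Q r2 m2 (Suc (Suc \<tau>2))"
        proof (rule wp_expand[OF layout2 assms(2,3)])
          show "\<forall>j<n. m2 (r2 rVis + j) = of_bool (j \<in> A)" using m2 r2 by simp
          show "queue qs r2 m2" by (rule queue2)
          show "length (expand trs (t, A, v) qs) \<le> K"
            using assms(9) True nonfull by (simp add: process_def)
          fix r' m' \<tau>'
          assume "\<forall>x<20. r' x = r2 x" "\<forall>a<r2 rQb. m' a = m2 a" "queue (expand trs (t, A, v) qs) r' m'"
            "\<tau>' \<le> Suc (Suc \<tau>2) + 16 * length trs + 4 + (n + 1) * (12 * K + 12)"
          then show "Q r' m' \<tau>'"
            by (intro assms(10)) (use True nonfull r1 r2 m2 \<tau>1 \<tau>2 L(7) in \<open>simp_all add: process_def\<close>)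
        qed (use r1 r2 fin in simp_all)
        then show ?thesis using True nonfull flags r1 r2 L by simp
      next
        case False
        then have "queue (process n trs (t, A, v) qs) r2 m2"
          using queue2 by (simp add: process_def)
        then have "Q r2 m2 (Suc (Suc (Suc \<tau>2)))"
          by (intro assms(10)) (use False nonfull r1 r2 m2 \<tau>1 \<tau>2 in simp_all)
        then show ?thesis using False nonfull flags r1 r2 L by simp
      qed
    qed
  qed
  show ?thesis
    unfolding body_def
    by (simp add: L(1) cells) (rule decoding; simp add: L(1) assms(8))
qed

lemma wp_explore:
  assumes "layout n trs r m" "distinct trs" "\<forall>(a, b, l)\<in>set trs. b < n" "finite (reach n (set trs))"
    "queue (map (\<lambda>v. (0, {v}, v)) [0..<n]) r m" "r rHp = r rQb" "r rRes = 0"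
    and "\<And>r' m' \<tau>'. r' rRes = of_bool (\<exists>t v. (t, {..<n}, v) \<in> reach n (set trs)) \<Longrightarrow>
      \<tau>' \<le> \<tau> + 1 + card (reach n (set trs)) *
        (12 * n + 16 * length trs + (n + 1) * (12 * card (reach n (set trs)) + 12) + 19) \<Longrightarrow> Q r' m' \<tau>'"
  shows "wp explore Q r m \<tau>"
proof -
  let ?R = "reach n (set trs)"
  let ?init = "map (\<lambda>v. (0, {v}, v)) [0..<n] :: config list"
  define K where "K = card ?R"
  define c where "c = 12 * n + 16 * length trs + (n + 1) * (12 * K + 12) + 19"
  \<comment> \<open>The first \<open>h\<close> entries are processed: closure under successors and
    the result flag refer to this prefix only, and each of its entries has been charged
    \<open>c\<close> steps.\<close>
  define inv where "inv = (\<lambda>r' m' \<tau>' qs h. layout n trs r' m' \<and> queue qs r' m' \<and> r' rQb = r rQb \<and>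
    r' rHp = r rQb + 3 * h \<and> h \<le> length qs \<and> distinct qs \<and> set qs \<subseteq> ?R \<and> set ?init \<subseteq> set qs \<and>
    (\<forall>x \<in> set (take h qs). succs n (set trs) x \<subseteq> set qs) \<and>
    r' rRes = of_bool (\<exists>t v. (t, {..<n}, v) \<in> set (take h qs)) \<and> \<tau>' \<le> \<tau> + h * c)"
  \<comment> \<open>A duplicate-free queue of reachable configurations has at most \<open>K\<close>
    entries, although the program does not know \<open>K\<close>.\<close>
  have length: "length qs \<le> K" if "distinct qs" "set qs \<subseteq> ?R" for qs
    using that assms(4) unfolding K_def by (metis card_mono distinct_card)
  show ?thesis
    unfolding explore_def
  \<comment> \<open>The measure is the distance of the read pointer from the end of a queue with
    \<open>K\<close> entries; the actual end moves during the loop.\<close>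
  proof (rule wp_while_invariant[where I = "\<lambda>r m \<tau>. \<exists>qs h. inv r m \<tau> qs h"
        and f = "\<lambda>r' m'. r rQb + 3 * K - r' rHp"])
    have "inv r m \<tau> ?init 0"
      using assms(1,5-7) unfolding inv_def by (auto simp: distinct_map inj_on_def intro: reach.start)
    then show "\<exists>qs h. inv r m \<tau> qs h" by blast
  next
    fix r1 m1 \<tau>1
    assume "\<exists>qs h. inv r1 m1 \<tau>1 qs h" "holds (Less rHp rTp) r1"
    then obtain qs h where inv: "inv r1 m1 \<tau>1 qs h" and less: "r1 rHp < r1 rTp" by auto
    note inv' = inv[unfolded inv_def]
    have h: "h < length qs" using inv' less by (auto simp: queue_def)
    obtain t A v where x: "qs ! h = (t, A, v)" using prod_cases3 by blast
    let ?qs = "process n trs (t, A, v) qs"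
    have "(t, A, v) \<in> ?R" using inv' h x by (metis nth_mem subset_iff)
    then have A: "A \<subseteq> {..<n}" and sub: "set ?qs \<subseteq> ?R"
      using reach_subset assms(3) succs_reach inv' by (blast, simp add: set_process)
    have dist: "distinct ?qs" using inv' distinct_process by blast
    obtain zs where zs: "?qs = qs @ zs" using process_append by blast
    have take: "take (Suc h) ?qs = take h qs @ [(t, A, v)]"
      using h x by (simp add: zs take_Suc_conv_app_nth)
    show "wp body (\<lambda>r' m' \<tau>'. (\<exists>qs h. inv r' m' \<tau>' qs h) \<and> r rQb + 3 * K - r' rHp < r rQb + 3 * K - r1 rHp)
       r1 m1 (Suc \<tau>1)"
    proof (rule wp_body[where A = A and qs = qs and h = h and K = K])
      show "layout n trs r1 m1" "queue qs r1 m1" "r1 rHp = r1 rQb + 3 * h" using inv' by simp_all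
      show "length ?qs \<le> K" using dist sub by (rule length)
      fix r' m' \<tau>'
      assume r': "\<forall>x. 2 \<le> x \<and> x < 10 \<longrightarrow> r' x = r1 x" "r' rRes = (if A = {..<n} then 1 else r1 rRes)"
        "r' rHp = r1 rQb + 3 * Suc h" and m': "\<forall>a<r1 rVis. m' a = m1 a" "queue ?qs r' m'"
        and \<tau>': "\<tau>' \<le> Suc \<tau>1 + 12 * n + 16 * length trs + (n + 1) * (12 * K + 12) + 18"
      have "layout n trs r' m'"
        by (rule layout_cong[of n trs r1 m1]) (use inv' r' m' in simp_all)
      \<comment> \<open>The 19 in \<open>c\<close> is the 18 of the loop body plus one step for the
        loop test.\<close>
      moreover have "\<tau>' \<le> \<tau> + Suc h * c"
        using \<tau>' inv' by (simp add: c_def)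
      moreover have "set ?init \<subseteq> set ?qs"
        using inv' by (simp only: set_process) blast
      moreover have "\<forall>x \<in> set (take (Suc h) ?qs). succs n (set trs) x \<subseteq> set ?qs"
        using inv' unfolding take set_process by (simp only: set_append Ball_def) force
      moreover have "r' rRes = of_bool (\<exists>t v. (t, {..<n}, v) \<in> set (take (Suc h) ?qs))"
        using inv' r'(2) unfolding take by (cases "A = {..<n}") auto
      moreover have "Suc h \<le> length ?qs"
        using h by (simp add: zs)
      ultimately have "inv r' m' \<tau>' ?qs (Suc h)"
        using inv' r' m'(2) dist sub unfolding inv_def by simp
      moreover have "h < K" using h length[of qs] inv' by linarith
      ultimately show "(\<exists>qs h. inv r' m' \<tau>' qs h) \<and> r rQb + 3 * K - r' rHp < r rQb + 3 * K - r1 rHp"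
        using inv' r' by auto
    qed (use assms(2,3) h x A in auto)
  next
    fix r1 m1 \<tau>1
    assume "\<exists>qs h. inv r1 m1 \<tau>1 qs h" "\<not> holds (Less rHp rTp) r1"
    then obtain qs h where inv: "inv r1 m1 \<tau>1 qs h" and le: "r1 rTp \<le> r1 rHp" by auto
    note inv' = inv[unfolded inv_def]
    have h: "h = length qs" using inv' le by (auto simp: queue_def)
    have "?R \<subseteq> set qs"
      by (rule reach_least) (use inv' h in auto)
    then have R: "set qs = ?R" using inv' by blast
    then have "h = K" using h inv' K_def distinct_card by metis
    then show "Q r1 m1 (Suc \<tau>1)"
      by (intro assms(8)) (use inv' h R in \<open>simp_all add: c_def K_def\<close>)
  qed
qed

section \<open>Reading the input\<close>

abbreviation (input) "rPtr \<equiv> 38 :: reg"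
abbreviation (input) "rEdges \<equiv> 39 :: reg"
abbreviation (input) "rLabels \<equiv> 40 :: reg"
abbreviation (input) "rU \<equiv> 41 :: reg"
abbreviation (input) "rW \<equiv> 42 :: reg"
abbreviation (input) "rL \<equiv> 43 :: reg"
abbreviation (input) "rI \<equiv> 44 :: reg"

definition enc_edges :: "(nat \<times> nat \<times> nat list) list \<Rightarrow> nat list" where
  "enc_edges es = concat (map (\<lambda>(u, v, ts). u # v # length ts # ts) es)"

definition label_arcs :: "nat \<Rightarrow> nat \<Rightarrow> nat list \<Rightarrow> (nat \<times> nat \<times> nat) list" where
  "label_arcs u w ts = concat (map (\<lambda>l. [(u, w, l), (w, u, l)]) ts)"

definition arcs :: "(nat \<times> nat \<times> nat list) list \<Rightarrow> (nat \<times> nat \<times> nat) list" where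
  "arcs es = concat (map (\<lambda>(u, w, ts). label_arcs u w ts) es)"

text \<open>A preliminary pass that yields only the address of the end of the input, where the
  working arrays begin; the input does not state its own length.\<close>

definition skip_edges :: com where
  "skip_edges = While (Less rZero rEdges)
     (Sub rEdges rEdges rOne ;; Add rPtr rPtr rOne ;; Add rPtr rPtr rOne ;;
      next_cell rX rPtr ;; Add rPtr rPtr rX)"

definition emit :: "reg \<Rightarrow> reg \<Rightarrow> com" where
  "emit i j = (put_cell rVis i ;; put_cell rVis j ;; put_cell rVis rL ;;
     Add rX rMx i ;; Load rA rX ;; Cond (Less rA rL) (Store rX rL) Skip)"

definition read_labels :: com where
  "read_labels = While (Less rZero rLabels)
     (Sub rLabels rLabels rOne ;; next_cell rL rPtr ;; emit rU rW ;; emit rW rU)"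

definition read_edges :: com where
  "read_edges = While (Less rZero rEdges)
     (Sub rEdges rEdges rOne ;; next_cell rU rPtr ;; next_cell rW rPtr ;; next_cell rLabels rPtr ;;
      read_labels)"

lemma wp_skip_edges:
  assumes "r rEdges = length es" "seg m (r rPtr) (enc_edges es)" "r rOne = 1" "r rZero = 0"
    and "\<And>r' \<tau>'. (\<forall>x<31. r' x = r x) \<Longrightarrow> r' rPtr = r rPtr + length (enc_edges es) \<Longrightarrow>
      \<tau>' \<le> \<tau> + 7 * length es + 1 \<Longrightarrow> Q r' m \<tau>'"
  shows "wp skip_edges Q r m \<tau>"
  using assms
proof (induction es arbitrary: r \<tau>)
  case Nil
  then show ?case unfolding skip_edges_def by (subst wp_While) (simp add: enc_edges_def)
next
  case (Cons e es)
  obtain u w ts where e: "e = (u, w, ts)" using prod_cases3 by blast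
  have step: "wp skip_edges Q r1 m \<tau>1"
    if "\<forall>x<31. r1 x = r x" "r1 rEdges = length es" "r1 rPtr = r rPtr + 3 + length ts" "\<tau>1 \<le> \<tau> + 7" for r1 \<tau>1
  proof (rule Cons.IH)
    show "seg m (r1 rPtr) (enc_edges es)"
      using Cons.prems(2) that(3) by (simp add: enc_edges_def e add.commute add.left_commute numeral_3_eq_3)
    fix r' \<tau>'
    assume *: "\<forall>x<31. r' x = r1 x" "r' rPtr = r1 rPtr + length (enc_edges es)" "\<tau>' \<le> \<tau>1 + 7 * length es + 1"
    show "Q r' m \<tau>'"
      by (rule Cons.prems(5)) (use * that in \<open>simp_all add: enc_edges_def e\<close>)
  qed (use Cons.prems that in simp_all)
  have "m (Suc (Suc (r rPtr))) = length ts" "r rEdges = Suc (length es)" "r rOne = Suc 0" "r rZero = 0"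
    using Cons.prems(1-4) by (simp_all add: enc_edges_def e)
  then show ?case
    unfolding skip_edges_def
    by (subst wp_While, fold skip_edges_def) (simp, rule step; simp)
qed

text \<open>The invariant of reading. Until the last arc is stored, \<open>rVis\<close> is the write
  pointer behind the arcs; afterwards it is the base of the membership flags.\<close>

definition arcs_at :: "nat \<Rightarrow> (nat \<times> nat \<times> nat) list \<Rightarrow> (reg \<Rightarrow> nat) \<Rightarrow> (nat \<Rightarrow> nat) \<Rightarrow> bool" where
  "arcs_at n trs r m \<longleftrightarrow> r rTr = r rMx + n \<and> r rVis = r rTr + 3 * length trs \<and>
     seg m (r rTr) (flat trs) \<and> (\<forall>j<n. \<forall>t. t < m (r rMx + j) \<longleftrightarrow> alive (set trs) t j)"

lemma arcs_at_cong:
  assumes "arcs_at n trs r m" "r' rMx = r rMx" "r' rTr = r rTr" "r' rVis = r rVis"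
  shows "arcs_at n trs r' m"
  using assms(1) unfolding arcs_at_def assms(2-4) .

lemma alive_insert: "alive (insert (a, b, l) E) t u \<longleftrightarrow> a = u \<and> t < l \<or> alive E t u"
  by (auto simp: alive_def)

text \<open>The entry of the tail is a running maximum: \<open>t\<close> lies below the maximum of
  two labels iff it lies below one of them, which matches the effect of a new arc on
  \<open>alive\<close>.\<close>

lemma wp_emit:
  assumes "arcs_at n trs r m" "r i < n" "r rOne = 1" "i \<in> {rU, rW}" "j \<in> {rU, rW}"
    and "\<And>r' m' \<tau>'. (\<forall>x. x \<noteq> rVis \<longrightarrow> x \<noteq> rX \<longrightarrow> x \<noteq> rA \<longrightarrow> r' x = r x) \<Longrightarrow>
      (\<forall>a<r rMx. m' a = m a) \<Longrightarrow> arcs_at n (trs @ [(r i, r j, r rL)]) r' m' \<Longrightarrow>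
      \<tau>' \<le> \<tau> + 10 \<Longrightarrow> Q r' m' \<tau>'"
  shows "wp (emit i j) Q r m \<tau>"
proof -
  let ?m = "m(r rVis := r i, Suc (r rVis) := r j, Suc (Suc (r rVis)) := r rL)"
  let ?x = "r rMx + r i"
  let ?m' = "if m ?x < r rL then ?m(?x := r rL) else ?m"
  note A = assms(1)[unfolded arcs_at_def]
  have ne: "?x \<noteq> r rVis" "?x \<noteq> Suc (r rVis)" "?x \<noteq> Suc (Suc (r rVis))" using A assms(2) by auto
  have low: "\<forall>a<r rMx. ?m' a = m a" using A assms(2) by auto
  have seg: "seg ?m' (r rTr) (flat (trs @ [(r i, r j, r rL)]))"
    using A assms(2) by auto
  have max: "?m' (r rMx + k) = (if k = r i then max (m (r rMx + k)) (r rL) else m (r rMx + k))" if "k < n" for k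
    using A assms(2) that by auto
  have arcs: "arcs_at n (trs @ [(r i, r j, r rL)]) r' ?m'"
    if "r' rTr = r rTr" "r' rMx = r rMx" "r' rVis = Suc (Suc (Suc (r rVis)))" for r'
    using A seg max unfolding arcs_at_def that
    by (auto simp: alive_insert less_max_iff_disj)
  have ij: "i \<noteq> 8" "i \<noteq> 31" "i \<noteq> 32" "i \<noteq> 2" "j \<noteq> 8" "j \<noteq> 31" "j \<noteq> 32" "j \<noteq> 2"
    using assms(4,5) by auto
  have one: "r rOne = Suc 0" using assms(3) by simp
  show ?thesis
  proof (cases "m ?x < r rL")
    case True
    show ?thesis
      unfolding emit_def using True
      apply (simp add: one ij ne)
      apply (rule assms(6))
      using low arcs True by simp_all
  next
    case False
    show ?thesis
      unfolding emit_def using False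
      apply (simp add: one ij ne)
      apply (rule assms(6))
      using low arcs False by simp_all
  qed
qed

text \<open>Unread input lies below \<open>rMx\<close>, so storing arcs cannot destroy it. The 24
  steps per label are four for fetching it and ten for each of its two arcs.\<close>

lemma wp_read_labels:
  assumes "arcs_at n trs r m" "r rLabels = length ts" "seg m (r rPtr) ts" "r rPtr + length ts \<le> r rMx"
    "r rOne = 1" "r rZero = 0" "r rU < n" "r rW < n"
    and "\<And>r' m' \<tau>'. (\<forall>x<31. x \<noteq> rVis \<longrightarrow> r' x = r x) \<Longrightarrow> r' rEdges = r rEdges \<Longrightarrow>
      r' rPtr = r rPtr + length ts \<Longrightarrow> (\<forall>a<r rMx. m' a = m a) \<Longrightarrow>
      arcs_at n (trs @ label_arcs (r rU) (r rW) ts) r' m' \<Longrightarrow>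
      \<tau>' \<le> \<tau> + 24 * length ts + 1 \<Longrightarrow> Q r' m' \<tau>'"
  shows "wp read_labels Q r m \<tau>"
  using assms
proof (induction ts arbitrary: trs r m \<tau>)
  case Nil
  then show ?case unfolding read_labels_def by (subst wp_While) (simp add: label_arcs_def)
next
  case (Cons l ts)
  have step: "wp read_labels Q r1 m1 \<tau>1"
    if r1: "\<forall>x<31. x \<noteq> rVis \<longrightarrow> r1 x = r x" "r1 rEdges = r rEdges" "r1 rU = r rU" "r1 rW = r rW"
      "r1 rPtr = Suc (r rPtr)" "r1 rLabels = length ts" and m1: "\<forall>a<r rMx. m1 a = m a"
      and arcs: "arcs_at n (trs @ [(r rU, r rW, l), (r rW, r rU, l)]) r1 m1" and \<tau>1: "\<tau>1 \<le> \<tau> + 24" for r1 m1 \<tau>1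
  proof (rule Cons.IH[OF arcs])
    show "seg m1 (r1 rPtr) ts"
      by (rule seg_cong[where m = m]) (use Cons.prems(3,4) r1 m1 in auto)
    fix r' m' \<tau>'
    assume "\<forall>x<31. x \<noteq> rVis \<longrightarrow> r' x = r1 x" "r' rEdges = r1 rEdges" "r' rPtr = r1 rPtr + length ts"
      "\<forall>a<r1 rMx. m' a = m1 a"
      "arcs_at n ((trs @ [(r rU, r rW, l), (r rW, r rU, l)]) @ label_arcs (r1 rU) (r1 rW) ts) r' m'"
      "\<tau>' \<le> \<tau>1 + 24 * length ts + 1"
    then show "Q r' m' \<tau>'"
      by (intro Cons.prems(9)) (use r1 m1 \<tau>1 in \<open>simp_all add: label_arcs_def\<close>)
  qed (use Cons.prems r1 in simp_all)
  have start: "wp (emit rU rW) (wp (emit rW rU) (wp read_labels Q)) r0 m \<tau>0"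
    if r0: "\<forall>x<31. r0 x = r x" "r0 rEdges = r rEdges" "r0 rU = r rU" "r0 rW = r rW"
      "r0 rPtr = Suc (r rPtr)" "r0 rLabels = length ts" "r0 rL = l" and \<tau>0: "\<tau>0 \<le> \<tau> + 4" for r0 \<tau>0
  proof (rule wp_emit)
    show "arcs_at n trs r0 m" by (rule arcs_at_cong[OF Cons.prems(1)]) (use r0(1) in simp_all)
    fix r1 m1 \<tau>1
    assume r1: "\<forall>x. x \<noteq> rVis \<longrightarrow> x \<noteq> rX \<longrightarrow> x \<noteq> rA \<longrightarrow> r1 x = r0 x" and m1: "\<forall>a<r0 rMx. m1 a = m a"
      and arcs1: "arcs_at n (trs @ [(r0 rU, r0 rW, r0 rL)]) r1 m1" and \<tau>1: "\<tau>1 \<le> \<tau>0 + 10"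
    show "wp (emit rW rU) (wp read_labels Q) r1 m1 \<tau>1"
    proof (rule wp_emit[OF arcs1])
      fix r2 m2 \<tau>2
      assume r2: "\<forall>x. x \<noteq> rVis \<longrightarrow> x \<noteq> rX \<longrightarrow> x \<noteq> rA \<longrightarrow> r2 x = r1 x" and m2: "\<forall>a<r1 rMx. m2 a = m1 a"
        and arcs2: "arcs_at n ((trs @ [(r0 rU, r0 rW, r0 rL)]) @ [(r1 rW, r1 rU, r1 rL)]) r2 m2"
        and \<tau>2: "\<tau>2 \<le> \<tau>1 + 10"
      show "wp read_labels Q r2 m2 \<tau>2"
        by (rule step) (use r0 r1 r2 m1 m2 arcs2 \<tau>0 \<tau>1 \<tau>2 in simp_all)
    qed (use Cons.prems(5,8) r0 r1 in simp_all)
  qed (use Cons.prems(5,7) r0 in simp_all)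
  have "m (r rPtr) = l" "r rLabels = Suc (length ts)" "r rOne = Suc 0" "r rZero = 0"
    using Cons.prems(2,3,5,6) by simp_all
  then show ?case
    unfolding read_labels_def
    by (subst wp_While, fold read_labels_def) (simp, rule start; simp)
qed

lemma length_label_arcs: "length (label_arcs u w ts) = 2 * length ts"
  by (induction ts) (simp_all add: label_arcs_def)

lemma wp_read_edges:
  assumes "arcs_at n trs r m" "r rEdges = length es" "seg m (r rPtr) (enc_edges es)"
    "r rPtr + length (enc_edges es) \<le> r rMx" "r rOne = 1" "r rZero = 0"
    "\<forall>(u, w, ts) \<in> set es. u < n \<and> w < n"
    and "\<And>r' m' \<tau>'. (\<forall>x<31. x \<noteq> rVis \<longrightarrow> r' x = r x) \<Longrightarrow> (\<forall>a<r rMx. m' a = m a) \<Longrightarrow>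
      arcs_at n (trs @ arcs es) r' m' \<Longrightarrow>
      \<tau>' \<le> \<tau> + 9 * length es + 12 * length (arcs es) + 1 \<Longrightarrow> Q r' m' \<tau>'"
  shows "wp read_edges Q r m \<tau>"
  using assms
proof (induction es arbitrary: trs r m \<tau>)
  case Nil
  then show ?case unfolding read_edges_def by (subst wp_While) (simp add: arcs_def)
next
  case (Cons e es)
  obtain u w ts where e: "e = (u, w, ts)" using prod_cases3 by blast
  have enc: "enc_edges (e # es) = u # w # length ts # ts @ enc_edges es"
    by (simp add: enc_edges_def e)
  have seg: "seg m (r rPtr) (u # w # length ts # ts @ enc_edges es)"
    using Cons.prems(3) by (simp only: enc)
  have bound: "r rPtr + 3 + length ts + length (enc_edges es) \<le> r rMx"
    using Cons.prems(4) by (simp add: enc)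
  have start: "wp read_labels (wp read_edges Q) r1 m \<tau>1"
    if r1: "\<forall>x<31. r1 x = r x" "r1 rEdges = length es" "r1 rU = u" "r1 rW = w"
      "r1 rPtr = Suc (Suc (Suc (r rPtr)))" "r1 rLabels = length ts" and \<tau>1: "\<tau>1 \<le> \<tau> + 8" for r1 \<tau>1
  proof (rule wp_read_labels)
    show "arcs_at n trs r1 m" by (rule arcs_at_cong[OF Cons.prems(1)]) (use r1(1) in simp_all)
    fix r2 m2 \<tau>2
    assume r2: "\<forall>x<31. x \<noteq> rVis \<longrightarrow> r2 x = r1 x" "r2 rEdges = r1 rEdges" "r2 rPtr = r1 rPtr + length ts"
      and m2: "\<forall>a<r1 rMx. m2 a = m a"
      and arcs2: "arcs_at n (trs @ label_arcs (r1 rU) (r1 rW) ts) r2 m2"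
      and \<tau>2: "\<tau>2 \<le> \<tau>1 + 24 * length ts + 1"
    show "wp read_edges Q r2 m2 \<tau>2"
    proof (rule Cons.IH[OF arcs2])
      show "seg m2 (r2 rPtr) (enc_edges es)"
        by (rule seg_cong[where m = m]) (use seg bound r1 r2 m2 in auto)
      show "r2 rPtr + length (enc_edges es) \<le> r2 rMx"
        using bound r1 r2 by simp
      fix r' m' \<tau>'
      assume "\<forall>x<31. x \<noteq> rVis \<longrightarrow> r' x = r2 x" "\<forall>a<r2 rMx. m' a = m2 a"
        "arcs_at n ((trs @ label_arcs (r1 rU) (r1 rW) ts) @ arcs es) r' m'"
        "\<tau>' \<le> \<tau>2 + 9 * length es + 12 * length (arcs es) + 1"
      then show "Q r' m' \<tau>'"
        by (intro Cons.prems(8))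
          (use r1 r2 m2 \<tau>1 \<tau>2 in \<open>simp_all add: arcs_def e length_label_arcs\<close>)
    qed (use Cons.prems(5-7) r1 r2 in simp_all)
  qed (use Cons.prems(5-7) bound seg r1 e in simp_all)
  have "m (r rPtr) = u" "m (Suc (r rPtr)) = w" "m (Suc (Suc (r rPtr))) = length ts"
    "r rEdges = Suc (length es)" "r rOne = Suc 0" "r rZero = 0"
    using seg Cons.prems(2,5,6) by simp_all
  then show ?case
    unfolding read_edges_def
    by (subst wp_While, fold read_edges_def) (simp, rule start; simp)
qed

section \<open>The program\<close>

text \<open>\<open>rB\<close> runs through the powers of two by doubling. Each value serves twice:
  as an entry of the table of powers and as the code of the singleton \<open>{i}\<close> in a start
  configuration.\<close>

definition init_queue :: com where
  "init_queue = While (Less rI rN)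
     (Add rX rPw rI ;; Store rX rB ;; put_cell rTp rZero ;; put_cell rTp rB ;; put_cell rTp rI ;;
      Add rB rB rB ;; Add rI rI rOne)"

definition main :: com where
  "main = (Const rOne 1 ;; Load rN rZero ;; Load rEdges rOne ;; Const rPtr 2 ;; skip_edges ;;
     Move rPw rPtr ;; Add rMx rPw rN ;; Add rTr rMx rN ;; Move rVis rTr ;;
     Load rEdges rOne ;; Const rPtr 2 ;; read_edges ;;
     Add rQb rVis rN ;; Move rTp rQb ;; Move rHp rQb ;; Const rI 0 ;; Const rB 1 ;;
     init_queue ;; explore)"

lemma wp_init_queue:
  assumes "r rI = i" "i \<le> n" "r rB = 2 ^ i" "r rN = n" "r rOne = 1" "r rZero = 0" "r rPw + n \<le> r rQb"
    "queue (map (\<lambda>v. (0, {v}, v)) [0..<i]) r m" "\<forall>j<i. m (r rPw + j) = 2 ^ j"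
    and "\<And>r' m' \<tau>'. (\<forall>x<30. r' x = r x) \<Longrightarrow>
      (\<forall>a<r rQb. a < r rPw \<or> r rPw + n \<le> a \<longrightarrow> m' a = m a) \<Longrightarrow> (\<forall>j<n. m' (r rPw + j) = 2 ^ j) \<Longrightarrow>
      queue (map (\<lambda>v. (0, {v}, v)) [0..<n]) r' m' \<Longrightarrow> \<tau>' \<le> \<tau> + 11 * (n - i) + 1 \<Longrightarrow> Q r' m' \<tau>'"
  shows "wp init_queue Q r m \<tau>"
  using assms
proof (induction "n - i" arbitrary: i r m \<tau>)
  case 0
  then show ?case unfolding init_queue_def by (subst wp_While) simp
next
  case (Suc k)
  let ?m = "m(r rPw + i := 2 ^ i, r rTp := 0, Suc (r rTp) := 2 ^ i, Suc (Suc (r rTp)) := i)"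
  have i: "i < n" using Suc.hyps(2) by simp
  note queue = Suc.prems(8)[unfolded queue_def]
  have step: "wp init_queue Q r1 ?m \<tau>1"
    if r1: "\<forall>x<30. r1 x = r x" "r1 rI = Suc i" "r1 rB = 2 ^ Suc i" "r1 rTp = Suc (Suc (Suc (r rTp)))"
      and \<tau>1: "\<tau>1 \<le> \<tau> + 11" for r1 \<tau>1
  proof (rule Suc.hyps(1)[of "Suc i"])
    have "seg ?m (r rQb) (flat (map code (map (\<lambda>v. (0, {v}, v)) [0..<Suc i])))"
      using queue i Suc.prems(7) by (simp add: code_def set_encode_def)
    then show "queue (map (\<lambda>v. (0, {v}, v)) [0..<Suc i]) r1 ?m"
      using queue r1 by (simp add: queue_def)
    show "\<forall>j<Suc i. ?m (r1 rPw + j) = 2 ^ j"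
      using Suc.prems(7,9) queue i r1 by (auto simp: less_Suc_eq)
    fix r' m' \<tau>'
    assume "\<forall>x<30. r' x = r1 x"
      "\<forall>a<r1 rQb. a < r1 rPw \<or> r1 rPw + n \<le> a \<longrightarrow> m' a = ?m a" "\<forall>j<n. m' (r1 rPw + j) = 2 ^ j"
      "queue (map (\<lambda>v. (0, {v}, v)) [0..<n]) r' m'" "\<tau>' \<le> \<tau>1 + 11 * (n - Suc i) + 1"
    then show "Q r' m' \<tau>'"
      by (intro Suc.prems(10)) (use r1 \<tau>1 i queue in auto)
  qed (use Suc.prems Suc.hyps(2) r1 i in simp_all)
  show ?case
    unfolding init_queue_def
    apply (subst wp_While, fold init_queue_def)
    apply (simp add: Suc.prems(1,3,4,6) Suc.prems(5)[simplified] i)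
    apply (rule step; simp)
    done
qed

lemma wp_main:
  assumes xs: "xs = n # length es # enc_edges es" and "distinct (arcs es)"
    and bounded: "\<forall>(u, w, ts) \<in> set es. u < n \<and> w < n" "\<forall>(a, b, l) \<in> set (arcs es). b < n"
    and fin: "finite (reach n (set (arcs es)))"
    and Q: "\<And>(r' :: reg \<Rightarrow> nat) (m' :: nat \<Rightarrow> nat) \<tau>'. r' rRes = of_bool (\<exists>t v. (t, {..<n}, v) \<in> reach n (set (arcs es))) \<Longrightarrow>
      \<tau>' \<le> 30 + 16 * length es + 12 * length (arcs es) + 11 * n + card (reach n (set (arcs es))) *
        (12 * n + 16 * length (arcs es) + (n + 1) * (12 * card (reach n (set (arcs es))) + 12) + 19) \<Longrightarrow>
      Q r' m' \<tau>'"
  shows "wp main Q (fst (initial_state xs)) (snd (initial_state xs)) 0"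
proof -
  define m where "m = snd (initial_state xs)"
  define rest where "rest = (Add rQb rVis rN ;; Move rTp rQb ;; Move rHp rQb ;; Const rI 0 ;; Const rB 1 ;;
     init_queue ;; explore)"
  define mid where "mid = (Move rPw rPtr ;; Add rMx rPw rN ;; Add rTr rMx rN ;; Move rVis rTr ;;
     Load rEdges rOne ;; Const rPtr 2 ;; read_edges ;; rest)"
  let ?L = "2 + length (enc_edges es)"
  have m: "m 0 = n" "m (Suc 0) = length es" "seg m 2 (enc_edges es)" "\<forall>a\<ge>?L. m a = 0"
    unfolding m_def initial_state_def xs by (auto simp: seg_def)
  have final: "wp rest Q r1 m1 \<tau>1"
    if r1: "r1 rOne = 1" "r1 rZero = 0" "r1 rN = n" "r1 rPw = ?L" "r1 rMx = ?L + n" "r1 rRes = 0"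
      and arcs: "arcs_at n (arcs es) r1 m1" and \<tau>1: "\<tau>1 \<le> 14 + 16 * length es + 12 * length (arcs es)" for r1 m1 \<tau>1
  proof -
    note A = arcs[unfolded arcs_at_def]
    have "wp init_queue (wp explore Q) r2 m1 \<tau>2"
      if r2: "\<forall>x<9. r2 x = r1 x" "r2 rQb = r1 rVis + n" "r2 rTp = r1 rVis + n" "r2 rHp = r1 rVis + n"
        "r2 rI = 0" "r2 rB = 1" and \<tau>2: "\<tau>2 \<le> \<tau>1 + 5" for r2 \<tau>2
    proof (rule wp_init_queue[where n = n])
      show "queue (map (\<lambda>v. (0, {v}, v)) [0..<0]) r2 m1"
        using r2 by (simp add: queue_def)
      fix r3 m3 \<tau>3
      assume r3: "\<forall>x<30. r3 x = r2 x"
        and m3: "\<forall>a<r2 rQb. a < r2 rPw \<or> r2 rPw + n \<le> a \<longrightarrow> m3 a = m1 a" "\<forall>j<n. m3 (r2 rPw + j) = 2 ^ j"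
        and queue: "queue (map (\<lambda>v. (0, {v}, v)) [0..<n]) r3 m3" and \<tau>3: "\<tau>3 \<le> \<tau>2 + 11 * (n - 0) + 1"
      have same: "m3 a = m1 a" if "?L + n \<le> a" "a < r1 rVis + n" for a
        using m3(1) r1 r2 that by simp
      have mx: "m3 (r1 rMx + j) = m1 (r1 rMx + j)" if "j < n" for j
        using same[of "r1 rMx + j"] A r1 that by simp
      have "seg m3 (r1 rTr) (flat (arcs es))"
        by (rule seg_cong[where m = m1]) (use A r1 same in auto)
      then have layout: "layout n (arcs es) r3 m3"
        using A r1 r2 r3 m3(2) mx unfolding layout_def by simp
      show "wp explore Q r3 m3 \<tau>3"
      proof (rule wp_explore[OF layout assms(2) bounded(2) fin queue])
        fix r' :: "reg \<Rightarrow> nat" and m' \<tau>'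
        assume "r' rRes = of_bool (\<exists>t v. (t, {..<n}, v) \<in> reach n (set (arcs es)))"
          "\<tau>' \<le> \<tau>3 + 1 + card (reach n (set (arcs es))) *
          (12 * n + 16 * length (arcs es) + (n + 1) * (12 * card (reach n (set (arcs es))) + 12) + 19)"
        then show "Q r' m' \<tau>'" using \<tau>1 \<tau>2 \<tau>3 by (intro Q) linarith+
      qed (use r1 r2 r3 in simp_all)
    qed (use r1 r2 A in simp_all)
    then show ?thesis
      unfolding rest_def by (simp add: r1)
  qed
  have middle: "wp mid Q r1 m \<tau>1"
    if r1: "r1 rOne = 1" "r1 rZero = 0" "r1 rN = n" "r1 rPtr = ?L" "r1 rRes = 0"
      and \<tau>1: "\<tau>1 \<le> 6 + 7 * length es" for r1 \<tau>1
  proof -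
    have "wp read_edges (wp rest Q) r2 m \<tau>2"
      if r2: "r2 rOne = 1" "r2 rZero = 0" "r2 rN = n" "r2 rPw = ?L" "r2 rMx = ?L + n" "r2 rTr = r2 rMx + n"
        "r2 rVis = r2 rTr" "r2 rRes = 0" "r2 rEdges = length es" "r2 rPtr = 2" and \<tau>2: "\<tau>2 \<le> \<tau>1 + 6" for r2 \<tau>2
    proof (rule wp_read_edges)
      \<comment> \<open>Memory behind the input is zero, which is the right latest label as long as
        no arc has been read.\<close>
      show "arcs_at n [] r2 m"
        using m(4) r2 by (simp add: arcs_at_def alive_def)
      fix r3 m3 \<tau>3
      assume "\<forall>x<31. x \<noteq> rVis \<longrightarrow> r3 x = r2 x" "arcs_at n ([] @ arcs es) r3 m3"
        "\<tau>3 \<le> \<tau>2 + 9 * length es + 12 * length (arcs es) + 1"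
      then show "wp rest Q r3 m3 \<tau>3"
        by (intro final) (use r2 \<tau>1 \<tau>2 in simp_all)
    qed (use r2 m bounded(1) in simp_all)
    then show ?thesis
      unfolding mid_def by (simp add: r1 m)
  qed
  have start: "wp skip_edges (wp mid Q) r1 m \<tau>1"
    if r1: "r1 rOne = 1" "r1 rZero = 0" "r1 rN = n" "r1 rPtr = 2" "r1 rRes = 0" "r1 rEdges = length es"
      and \<tau>1: "\<tau>1 \<le> 4" for r1 \<tau>1
  proof (rule wp_skip_edges)
    fix r' \<tau>'
    assume "\<forall>x<31. r' x = r1 x" "r' rPtr = r1 rPtr + length (enc_edges es)" "\<tau>' \<le> \<tau>1 + 7 * length es + 1"
    then show "wp mid Q r' m \<tau>'" by (intro middle) (use r1 \<tau>1 in simp_all)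
  qed (use r1 m in simp_all)
  have main: "wp main Q r0 m 0 \<longleftrightarrow>
      wp (Const rOne 1 ;; Load rN rZero ;; Load rEdges rOne ;; Const rPtr 2 ;; skip_edges ;; mid) Q r0 m 0" for r0
    by (simp only: main_def mid_def rest_def)
  have "wp main Q (\<lambda>_. 0) m 0"
    unfolding main by (simp add: m) (rule start; simp)
  then show ?thesis by (simp add: m_def initial_state_def)
qed

section \<open>Reachable configurations and temporal paths\<close>

definition time_arcs :: "nat tgraph \<Rightarrow> (nat \<times> nat \<times> nat) set" where
  "time_arcs G = {(u, w, l). {u, w} \<in> edges G \<and> l \<in> labels G {u, w}}"

lemma temporal_path_snoc:
  assumes "temporal_path G vs p" "{last vs, w} \<in> edges G" "l \<in> labels G {last vs, w}"
    "w \<in> verts G" "w \<notin> set vs" "p \<noteq> [] \<Longrightarrow> snd (last p) < l"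
  shows "temporal_path G (vs @ [w]) (p @ [({last vs, w}, l)])"
proof -
  have len: "length vs = Suc (length p)" using assms(1) by (simp add: temporal_path_def)
  then have last: "last vs = vs ! length p" by (cases "vs = []") (simp_all add: last_conv_nth)
  let ?p = "p @ [({last vs, w}, l)]"
  have "fst (?p ! i) = {(vs @ [w]) ! i, (vs @ [w]) ! Suc i} \<and>
      fst (?p ! i) \<in> edges G \<and> snd (?p ! i) \<in> labels G (fst (?p ! i))" if "i < length ?p" for i
  proof (cases "i < length p")
    case True
    then have "?p ! i = p ! i" "(vs @ [w]) ! i = vs ! i" "(vs @ [w]) ! Suc i = vs ! Suc i"
      using len by (simp_all add: nth_append)
    then show ?thesis using assms(1) True unfolding temporal_path_def by metis
  next
    case False
    then have "i = length p" using that by simp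
    then show ?thesis using assms(2,3) len last by (simp add: nth_append)
  qed
  moreover have "snd (?p ! i) < snd (?p ! Suc i)" if "Suc i < length ?p" for i
  proof (cases "Suc i = length p")
    case True
    then show ?thesis using assms(6) by (cases p rule: rev_cases) (auto simp: nth_append)
  next
    case False
    then show ?thesis using assms(1) that by (simp add: temporal_path_def nth_append)
  qed
  moreover have "length (vs @ [w]) = Suc (length ?p)" "set (vs @ [w]) \<subseteq> verts G" "distinct (vs @ [w])"
    using assms(1,4,5) by (simp_all add: temporal_path_def)
  ultimately show ?thesis unfolding temporal_path_def by blast
qed

text \<open>Soundness of the search. The clause on the last label is the one that makes a further
  label \<open>Suc t\<close> strictly larger; the empty path has no last label and needs no
  bound.\<close>

lemma reach_imp_temporal_path:
  assumes "(t, A, v) \<in> reach n (time_arcs G)" "verts G = {..<n}" "temporal_graph G"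
  shows "\<exists>vs p. temporal_path G vs p \<and> set vs = A \<and> last vs = v \<and> (p \<noteq> [] \<longrightarrow> snd (last p) \<le> t)"
  using assms(1)
proof induction
  case (start v)
  then have "temporal_path G [v] []" using assms(2) by (simp add: temporal_path_def)
  then show ?case by force
next
  case (wait t A v)
  then show ?case using le_SucI by metis
next
  case (move t A v w)
  then obtain vs p where p: "temporal_path G vs p" "set vs = A" "last vs = v" "p \<noteq> [] \<longrightarrow> snd (last p) \<le> t"
    by blast
  have e: "{v, w} \<in> edges G" "Suc t \<in> labels G {v, w}" using move by (simp_all add: time_arcs_def)
  then have "w \<in> verts G" using assms(3) by (auto simp: temporal_graph_def)
  then have "temporal_path G (vs @ [w]) (p @ [({last vs, w}, Suc t)])"
    using p e move by (intro temporal_path_snoc) auto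
  then show ?case using p by (intro exI[of _ "vs @ [w]"] exI[of _ "p @ [({last vs, w}, Suc t)]"]) auto
qed

lemma temporal_path_times_less:
  assumes "temporal_path G vs p" "i < j" "j < length p"
  shows "snd (p ! i) < snd (p ! j)"
  using assms(2,3)
proof (induction j)
  case (Suc j)
  then have "snd (p ! j) < snd (p ! Suc j)" using assms(1) by (simp add: temporal_path_def)
  then show ?case using Suc by (cases "i = j") auto
qed simp

text \<open>Completeness: the search can follow a given Hamiltonian path, standing at time
  \<open>t\<close> at the end of a prefix whose remaining labels all exceed \<open>t\<close>. The
  first alternative is needed because a full configuration is not expanded, so the simulation may
  stop before time \<open>t\<close>.\<close>

lemma temporal_path_reach:
  assumes path: "temporal_path G vs p" and spanning: "verts G \<subseteq> set vs"
    and V: "verts G = {..<n}" and G: "temporal_graph G"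
  shows "(\<exists>t' v. (t', {..<n}, v) \<in> reach n (time_arcs G)) \<or>
    (\<exists>k\<le>length p. (t, set (take (Suc k) vs), vs ! k) \<in> reach n (time_arcs G) \<and>
      (\<forall>i<length p. k \<le> i \<longrightarrow> t < snd (p ! i)))"
proof (induction t)
  case 0
  have len: "length vs = Suc (length p)" and sub: "set vs = {..<n}"
    using path spanning V by (auto simp: temporal_path_def)
  \<comment> \<open>Labels are positive, so at time 0 the entire path still lies ahead.\<close>
  have "0 < snd (p ! i)" if "i < length p" for i
    using path G that unfolding temporal_path_def temporal_graph_def by (metis gr0I)
  moreover have "(0, set (take (Suc 0) vs), vs ! 0) \<in> reach n (time_arcs G)"
  proof -
    obtain v vs' where "vs = v # vs'" using len by (cases vs) auto
    then show ?thesis using sub by (auto intro: reach.start)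
  qed
  ultimately show ?case by blast
next
  case (Suc t)
  have len: "length vs = Suc (length p)" and sub: "set vs = {..<n}"
    using path spanning V by (auto simp: temporal_path_def)
  have edge: "{vs ! i, vs ! Suc i} \<in> edges G" "snd (p ! i) \<in> labels G {vs ! i, vs ! Suc i}"
    if "i < length p" for i
    using path that by (auto simp: temporal_path_def)
  show ?case
  proof (cases "\<exists>t' v. (t', {..<n}, v) \<in> reach n (time_arcs G)")
    case False
    then obtain k where k: "k \<le> length p" "(t, set (take (Suc k) vs), vs ! k) \<in> reach n (time_arcs G)"
      "\<forall>i<length p. k \<le> i \<longrightarrow> t < snd (p ! i)"
      using Suc.IH by blast
    let ?A = "set (take (Suc k) vs)"
    have nonfull: "?A \<noteq> {..<n}" using False k(2) by metis
    then have less: "k < length p" using k(1) len sub by (cases "k = length p") auto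
    have good: "good n (time_arcs G) t ?A"
      unfolding good_def
    proof (intro allI impI)
      fix u assume "u < n" "u \<notin> ?A"
      then obtain j where j: "j < length vs" "vs ! j = u"
        using sub by (metis in_set_conv_nth lessThan_iff)
      have "\<not> j < Suc k"
        using j \<open>u \<notin> ?A\<close> by (metis in_set_conv_nth length_take min_less_iff_conj nth_take)
      then obtain i where i: "j = Suc i" "k \<le> i" "i < length p"
        using j len by (cases j) auto
      \<comment> \<open>The witness is the edge by which the path will enter \<open>u\<close>, read
        backwards; this is why pruning spares every prefix of a Hamiltonian path.\<close>
      then have "(u, vs ! i, snd (p ! i)) \<in> time_arcs G"
        using edge[of i] j by (simp add: time_arcs_def insert_commute)
      then show "alive (time_arcs G) t u"
        using k(3) i by (auto simp: alive_def)
    qed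
    show ?thesis
    proof (cases "snd (p ! k) = Suc t")
      case True
      have take: "set (take (Suc (Suc k)) vs) = insert (vs ! Suc k) ?A"
        using less len by (simp add: take_Suc_conv_app_nth insert_commute)
      have "vs ! Suc k \<notin> ?A"
      proof
        assume "vs ! Suc k \<in> ?A"
        then obtain i where "i < Suc k" "vs ! i = vs ! Suc k"
          by (metis in_set_conv_nth length_take min_less_iff_conj nth_take)
        then show False
          using path less len nth_eq_iff_index_eq[of vs i "Suc k"] by (auto simp: temporal_path_def)
      qed
      then have "(Suc t, set (take (Suc (Suc k)) vs), vs ! Suc k) \<in> reach n (time_arcs G)"
        unfolding take using reach.move[OF k(2) nonfull good] edge[OF less] True
        by (simp add: time_arcs_def)
      moreover have "\<forall>i<length p. Suc k \<le> i \<longrightarrow> Suc t < snd (p ! i)"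
        using temporal_path_times_less[OF path, of k] True by (metis Suc_le_lessD)
      ultimately show ?thesis using less by (intro disjI2 exI[of _ "Suc k"]) auto
    next
      case no_move: False
      have "Suc t < snd (p ! i)" if "i < length p" "k \<le> i" for i
      proof -
        have "Suc t < snd (p ! k)" using no_move k(3) less by (metis Suc_lessI order_refl)
        then show ?thesis
          using that temporal_path_times_less[OF path, of k i] by (cases "k = i") auto
      qed
      then show ?thesis using reach.wait[OF k(2) nonfull good] k(1) by blast
    qed
  qed simp
qed

lemma temporal_hamiltonian_iff_reach:
  assumes "verts G = {..<n}" "temporal_graph G"
  shows "temporal_hamiltonian G \<longleftrightarrow> (\<exists>t v. (t, {..<n}, v) \<in> reach n (time_arcs G))"
proof
  assume "temporal_hamiltonian G"
  then obtain vs p where p: "temporal_path G vs p" "verts G \<subseteq> set vs"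
    by (auto simp: temporal_hamiltonian_def)
  then have len: "length vs = Suc (length p)" and sub: "set vs = {..<n}"
    using assms by (auto simp: temporal_path_def)
  \<comment> \<open>Any time not below a label of \<open>p\<close> will do; the sum also covers the
    empty path.\<close>
  let ?T = "sum_list (map snd p)"
  from temporal_path_reach[OF p assms, of ?T]
  show "\<exists>t v. (t, {..<n}, v) \<in> reach n (time_arcs G)"
  proof
    assume "\<exists>k\<le>length p. (?T, set (take (Suc k) vs), vs ! k) \<in> reach n (time_arcs G) \<and>
      (\<forall>i<length p. k \<le> i \<longrightarrow> ?T < snd (p ! i))"
    then obtain k where k: "k \<le> length p" "(?T, set (take (Suc k) vs), vs ! k) \<in> reach n (time_arcs G)"
      "\<forall>i<length p. k \<le> i \<longrightarrow> ?T < snd (p ! i)"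
      by blast
    have "snd (p ! i) \<le> ?T" if "i < length p" for i
      using that by (intro member_le_sum_list) auto
    then have "k = length p" using k(1,3) by (metis le_neq_implies_less not_le order_refl)
    then show ?thesis using k(2) len sub by auto
  qed
next
  assume "\<exists>t v. (t, {..<n}, v) \<in> reach n (time_arcs G)"
  then obtain t v where "(t, {..<n}, v) \<in> reach n (time_arcs G)" by blast
  from reach_imp_temporal_path[OF this assms] assms(1)
  show "temporal_hamiltonian G" by (auto simp: temporal_hamiltonian_def)
qed

section \<open>Counting reachable configurations\<close>

text \<open>These are the two facts behind the count. Visited vertices have an arc up to time
  \<open>t\<close>, since each was entered or left by then; unvisited ones have an arc from time
  \<open>t\<close> on, by goodness of the predecessor at time \<open>t - 1\<close>.\<close>

lemma reach_invariant:
  assumes "(t, A, v) \<in> reach n E" "\<forall>(a, b, l) \<in> E. b < n \<and> l \<le> B \<and> (b, a, l) \<in> E"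
  shows "v < n \<and> A \<subseteq> {..<n} \<and> (A = {v} \<or> (\<forall>u\<in>A. \<exists>w l. (u, w, l) \<in> E \<and> l \<le> t)) \<and>
    (if t = 0 then A = {v} else t \<le> B \<and> (\<forall>u<n. u \<notin> A \<longrightarrow> (\<exists>w l. (u, w, l) \<in> E \<and> t \<le> l)))"
  using assms(1)
proof induction
  case (start v)
  then show ?case by simp
next
  case (wait t A v)
  \<comment> \<open>A missing vertex exists, and goodness gives it an arc after \<open>t\<close>.
    Its label bounds \<open>Suc t\<close>, so time never passes the largest label.\<close>
  have "\<exists>u<n. u \<notin> A" using wait.hyps(2) wait.IH by blast
  then obtain u w l where "(u, w, l) \<in> E" "t < l" using wait.hyps(3) by (auto simp: good_def alive_def)
  then have "Suc t \<le> B" using assms(2) by fastforce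
  moreover have "A = {v} \<or> (\<forall>u\<in>A. \<exists>w l. (u, w, l) \<in> E \<and> l \<le> Suc t)"
    using wait.IH by (meson le_SucI)
  ultimately show ?case
    using wait by (auto simp: good_def alive_def Suc_le_eq)
next
  case (move t A v w)
  have vw: "(w, v, Suc t) \<in> E" "w < n" "Suc t \<le> B" using assms(2) move by auto
  \<comment> \<open>On the first move the arc itself supplies a label for the start vertex; its
    reverse always supplies one for the new vertex.\<close>
  have "\<exists>w' l. (u, w', l) \<in> E \<and> l \<le> Suc t" if "u \<in> insert w A" for u
    using that vw(1) move le_SucI by (metis insertE order_refl singletonD)
  moreover have "\<forall>u<n. u \<notin> A \<longrightarrow> (\<exists>w l. (u, w, l) \<in> E \<and> Suc t \<le> l)"
    using move by (auto simp: good_def alive_def Suc_le_eq)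
  ultimately show ?case using move vw by auto
qed

text \<open>Kept apart from the count in terms of the width: termination and correctness are also
  claimed for graphs without active edges, where lifetime and width have no meaning.\<close>

lemma finite_reach:
  assumes "finite E" "\<forall>(a, b, l) \<in> E. b < n \<and> (b, a, l) \<in> E"
  shows "finite (reach n E)"
proof -
  obtain B where "\<forall>x\<in>E. snd (snd x) \<le> B"
    using assms(1) by (metis finite_imageI finite_nat_set_iff_bounded_le image_eqI)
  then have B: "\<forall>(a, b, l) \<in> E. b < n \<and> l \<le> B \<and> (b, a, l) \<in> E" using assms(2) by fastforce
  have "reach n E \<subseteq> {..B} \<times> Pow {..<n} \<times> {..<n}"
    using reach_invariant[OF _ B] by (fastforce split: if_splits)
  then show ?thesis by (rule finite_subset) simp
qed

text \<open>At time \<open>t\<close> a visited set contains every vertex whose arcs all lie before \<open>t\<close>, and, unless it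
  consists of the start vertex only, no vertex whose arcs all lie after \<open>t\<close>. So it is determined by
  its intersection with \<open>F t\<close>.\<close>

lemma card_reach_le:
  assumes E: "\<forall>(a, b, l) \<in> E. b < n \<and> l \<le> B \<and> (b, a, l) \<in> E"
    and F: "\<And>t u w w' l l'. (u, w, l) \<in> E \<Longrightarrow> (u, w', l') \<in> E \<Longrightarrow> l \<le> t \<Longrightarrow> t \<le> l' \<Longrightarrow> u \<in> F t"
    and card: "\<And>t. t \<in> {1..B} \<Longrightarrow> finite (F t) \<and> card (F t) \<le> \<omega>"
  shows "card (reach n E) \<le> n + B * n + B * 2 ^ \<omega> * n"
proof -
  \<comment> \<open>The vertices that can no longer be entered at time \<open>t\<close> or later,
    including those without any arc.\<close>
  define D where "D t = {u. u < n \<and> \<not> (\<exists>w l. (u, w, l) \<in> E \<and> t \<le> l)}" for t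
  \<comment> \<open>Three families: the start configurations, those still waiting at their start
    vertex, and those that may have moved. Only the last depends on the VIM set.\<close>
  let ?X = "(\<lambda>v. (0, {v}, v)) ` {..<n} :: config set"
  let ?Y = "(\<lambda>(t, v). (t, {v}, v)) ` ({1..B} \<times> {..<n}) :: config set"
  let ?Z = "\<lambda>t. (\<lambda>(X, v). (t, D t \<union> X, v)) ` (Pow (F t) \<times> {..<n}) :: config set"
  have cover: "x \<in> ?X \<union> ?Y \<union> (\<Union>t\<in>{1..B}. ?Z t)" if "x \<in> reach n E" for x
  proof -
    obtain t A v where x: "x = (t, A, v)" using prod_cases3 by blast
    note inv = reach_invariant[OF that[unfolded x] E]
    show ?thesis
    proof (cases "A = {v}")
      case True
      then show ?thesis using inv x by (cases "t = 0") (auto simp: image_iff)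
    next
      case False
      then have t: "t \<in> {1..B}" using inv by (cases "t = 0") auto
      have "A = D t \<union> (A \<inter> F t)"
      proof (intro equalityI subsetI)
        fix u assume "u \<in> A"
        then obtain w l where "(u, w, l) \<in> E" "l \<le> t" "u < n" using False inv by blast
        then show "u \<in> D t \<union> (A \<inter> F t)" using F \<open>u \<in> A\<close> by (auto simp: D_def)
      next
        fix u assume "u \<in> D t \<union> (A \<inter> F t)"
        then show "u \<in> A" using inv t by (auto simp: D_def)
      qed
      then have "x \<in> ?Z t" using x inv by (auto simp: image_iff)
      then show ?thesis using t by blast
    qed
  qed
  have "card (reach n E) \<le> card (?X \<union> ?Y \<union> (\<Union>t\<in>{1..B}. ?Z t))"
  proof (rule card_mono)
    show "finite (?X \<union> ?Y \<union> (\<Union>t\<in>{1..B}. ?Z t))" using card by simp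
  qed (rule subsetI, rule cover)
  also have "\<dots> \<le> card ?X + card ?Y + card (\<Union>t\<in>{1..B}. ?Z t)"
    using card_Un_le[of "?X \<union> ?Y" "\<Union>t\<in>{1..B}. ?Z t"] card_Un_le[of ?X ?Y] by linarith
  also have "card ?X \<le> n" using card_image_le[of "{..<n}" "\<lambda>v. (0, {v}, v) :: config"] by simp
  also have "card ?Y \<le> B * n"
    using card_image_le[of "{1..B} \<times> {..<n}" "\<lambda>(t, v). (t, {v}, v) :: config"] by (simp add: card_cartesian_product)
  also have "card (\<Union>t\<in>{1..B}. ?Z t) \<le> (\<Sum>t\<in>{1..B}. card (?Z t))"
    by (rule card_UN_le) simp
  also have "\<dots> \<le> (\<Sum>t\<in>{1..B}. 2 ^ \<omega> * n)"
  proof (rule sum_mono)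
    fix t assume t: "t \<in> {1..B}"
    then have "card (?Z t) \<le> card (Pow (F t) \<times> {..<n})"
      using card by (intro card_image_le) auto
    also have "\<dots> = 2 ^ card (F t) * n"
      using card[OF t] by (simp add: card_cartesian_product card_Pow)
    also have "\<dots> \<le> 2 ^ \<omega> * n" using card[OF t] by (simp add: power_increasing)
    finally show "card (?Z t) \<le> 2 ^ \<omega> * n" .
  qed
  finally show ?thesis by simp
qed

section \<open>Correctness and running time\<close>

lemma set_label_arcs: "set (label_arcs u w ts) = {(a, b, l). l \<in> set ts \<and> ((a, b) = (u, w) \<or> (a, b) = (w, u))}"
  by (auto simp: label_arcs_def)

lemma set_arcs:
  assumes "edges G = set (map (\<lambda>(u, v, ts). {u, v}) es)"
    "\<forall>(u, v, ts) \<in> set es. distinct ts \<and> set ts = labels G {u, v}"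
  shows "set (arcs es) = time_arcs G"
proof -
  have "x \<in> set (arcs es) \<longleftrightarrow> x \<in> time_arcs G" for x
  proof -
    obtain a b l where x: "x = (a, b, l)" using prod_cases3 by blast
    have "x \<in> set (arcs es) \<longleftrightarrow> (\<exists>(u, v, ts) \<in> set es. {a, b} = {u, v} \<and> l \<in> set ts)"
      by (auto simp: x arcs_def set_label_arcs doubleton_eq_iff)
    also have "\<dots> \<longleftrightarrow> x \<in> time_arcs G"
      using assms(2) by (fastforce simp: x time_arcs_def assms(1))
    finally show ?thesis .
  qed
  then show ?thesis by blast
qed

lemma distinct_label_arcs: "distinct ts \<Longrightarrow> u \<noteq> w \<Longrightarrow> distinct (label_arcs u w ts)"
  by (induction ts) (auto simp: label_arcs_def)

text \<open>Arcs of different edges have different endpoint pairs; arcs of the same edge differ in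
  label or, as there are no loops, in direction.\<close>

lemma distinct_arcs:
  assumes "distinct (map (\<lambda>(u, v, ts). {u, v}) es)" "\<forall>(u, v, ts) \<in> set es. u \<noteq> v \<and> distinct ts"
  shows "distinct (arcs es)"
  using assms
proof (induction es)
  case (Cons e es)
  obtain u w ts where e: "e = (u, w, ts)" using prod_cases3 by blast
  have 1: "{a, b} = {u, w}" if "(a, b, l) \<in> set (label_arcs u w ts)" for a b l
    using that by (auto simp: set_label_arcs)
  have 2: "{a, b} \<in> set (map (\<lambda>(u, v, ts). {u, v}) es)" if "(a, b, l) \<in> set (arcs es)" for a b l
    using that by (force simp: arcs_def set_label_arcs insert_commute)
  have "{u, w} \<notin> set (map (\<lambda>(u, v, ts). {u, v}) es)"
    using Cons.prems(1) by (simp only: e list.map prod.case distinct.simps) blast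
  then have "(a, b, l) \<notin> set (label_arcs u w ts) \<inter> set (arcs es)" for a b l
    using 1[of a b l] 2[of a b l] by auto
  then have "set (label_arcs u w ts) \<inter> set (arcs es) = {}"
    by (metis equals0I prod_cases3)
  moreover have "distinct (arcs es)" using Cons by simp
  ultimately show ?case
    using Cons.prems(2) distinct_label_arcs by (simp add: arcs_def e)
qed (simp add: arcs_def)

text \<open>Everything is measured against \<open>Z = n * y * y\<close> with
  \<open>y = \<Lambda> * n * 2 ^ \<omega>\<close>. Each of the three terms in the bound on
  \<open>K\<close> is at most \<open>y\<close>, and the dominant cost is that of the queue
  searches.\<close>

lemma running_time_bound:
  fixes n \<Lambda> \<omega> K M e :: nat
  assumes "1 \<le> n" "1 \<le> \<Lambda>" "K \<le> n + \<Lambda> * n + \<Lambda> * 2 ^ \<omega> * n" "M \<le> n * n * \<Lambda>" "e \<le> n * n"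
  shows "30 + 16 * e + 12 * M + 11 * n + K * (12 * n + 16 * M + (n + 1) * (12 * K + 12) + 19)
    \<le> 500 * (\<Lambda> ^ 2 * n ^ 3 * 3 ^ (2 * \<omega>))"
proof -
  define P :: nat where "P = 2 ^ \<omega>"
  define y where "y = \<Lambda> * n * P"
  define Z where "Z = n * (y * y)"
  have P: "1 \<le> P" by (simp add: P_def)
  have "n \<le> y" "\<Lambda> * n \<le> y" "n * \<Lambda> \<le> y" using assms(1,2) P by (simp_all add: y_def)
  have "\<Lambda> * 2 ^ \<omega> * n = y" by (simp add: y_def P_def)
  then have K: "K \<le> 3 * y" using assms(3) \<open>n \<le> y\<close> \<open>\<Lambda> * n \<le> y\<close> by linarith
  have y: "1 \<le> y" using assms(1,2) P by (simp add: y_def)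
  have yy: "y \<le> y * y" using y by simp
  have Z1: "y * y \<le> Z" using assms(1) by (simp add: Z_def)
  have Zy: "y \<le> Z" using yy Z1 by linarith
  have "M \<le> n * y" using assms(4) \<open>n * \<Lambda> \<le> y\<close>
    by (metis mult.assoc mult_le_mono2 order_trans)
  have nyZ: "n * y \<le> Z" using yy by (simp add: Z_def)
  have nnZ: "n * n \<le> Z" using \<open>n \<le> y\<close> nyZ by (meson mult_le_mono2 order_trans)
  have "K * M \<le> (3 * y) * (n * y)" using K \<open>M \<le> n * y\<close> by (rule mult_le_mono)
  then have KM: "K * M \<le> 3 * Z" by (simp add: Z_def algebra_simps)
  have "K * n \<le> (3 * y) * y" using K \<open>n \<le> y\<close> by (rule mult_le_mono)
  then have Kn: "K * n \<le> 3 * Z" using Z1 by linarith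
  have "12 * K + 12 \<le> 48 * y" using K y by linarith
  moreover have "n + 1 \<le> 2 * n" using assms(1) by simp
  ultimately have "K * ((n + 1) * (12 * K + 12)) \<le> (3 * y) * ((2 * n) * (48 * y))"
    using K by (intro mult_le_mono)
  \<comment> \<open>The factor 288 is \<open>3 * 2 * 48\<close>, where 48 comes from
    \<open>12 * (3 * y) + 12 * y\<close>.\<close>
  then have KK: "K * ((n + 1) * (12 * K + 12)) \<le> 288 * Z" by (simp add: Z_def algebra_simps)
  have "30 + 16 * e + 12 * M + 11 * n + K * (12 * n + 16 * M + (n + 1) * (12 * K + 12) + 19) =
    30 + 16 * e + 12 * M + 11 * n + 12 * (K * n) + 16 * (K * M) + K * ((n + 1) * (12 * K + 12)) + 19 * K"
    by (simp only: distrib_left mult.assoc mult.left_commute[of K] mult.commute[of K 19])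
  \<comment> \<open>The summands contribute 30, 16, 12, 11, 36, 48, 288 and 57 times
    \<open>Z\<close>, in total 498.\<close>
  also have "\<dots> \<le> 500 * Z"
    using KM Kn KK K Zy y nnZ nyZ assms(5) \<open>M \<le> n * y\<close> \<open>n \<le> y\<close> by linarith
  also have "Z = \<Lambda> ^ 2 * n ^ 3 * (P * P)"
    by (simp add: Z_def y_def power2_eq_square power3_eq_cube mult.assoc mult.commute mult.left_commute)
  also have "P * P = 4 ^ \<omega>"
    by (simp add: P_def flip: power_mult_distrib)
  \<comment> \<open>The base 3 enters only here; the search itself stays within
    \<open>4 ^ \<omega>\<close>.\<close>
  also have "(4::nat) ^ \<omega> \<le> 3 ^ (2 * \<omega>)"
    by (simp add: power_mult power_mono)
  finally show ?thesis by simp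
qed

section \<open>Lifetime and VIM sets in terms of time arcs\<close>

lemma finite_edges:
  assumes "temporal_graph G"
  shows "finite (edges G)"
proof (rule finite_subset)
  show "edges G \<subseteq> Pow (verts G)" using assms by (auto simp: temporal_graph_def)
qed (use assms in \<open>simp add: temporal_graph_def\<close>)

lemma label_le_lifetime:
  assumes "temporal_graph G" "e \<in> edges G" "l \<in> labels G e"
  shows "l \<le> lifetime G"
proof -
  have e: "e \<in> active_edges G" using assms by (auto simp: active_edges_def)
  have "finite (active_edges G)" using finite_edges[OF assms(1)] by (simp add: active_edges_def)
  then have "Max (labels G e) \<le> lifetime G" unfolding lifetime_def using e by simp
  moreover have "l \<le> Max (labels G e)" using assms by (simp add: temporal_graph_def)
  ultimately show ?thesis by linarith
qed

lemma card_vim_set_le: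
  assumes "temporal_graph G" "t \<in> {1..lifetime G}"
  shows "finite (vim_set G t) \<and> card (vim_set G t) \<le> vim_width G"
proof
  have "vim_set G t \<subseteq> verts G"
    using assms(1) by (auto simp: vim_set_def active_edges_def temporal_graph_def)
  then show "finite (vim_set G t)" using assms(1) finite_subset by (auto simp: temporal_graph_def)
  show "card (vim_set G t) \<le> vim_width G" unfolding vim_width_def using assms(2) by simp
qed

lemma in_vim_set:
  assumes "temporal_graph G" "(u, w, l) \<in> time_arcs G" "(u, w', l') \<in> time_arcs G" "l \<le> t" "t \<le> l'"
  shows "u \<in> vim_set G t"
proof -
  have "{u, w} \<in> active_edges G" "{u, w'} \<in> active_edges G"
    using assms(2,3) by (auto simp: time_arcs_def active_edges_def)
  moreover have "Min (labels G {u, w}) \<le> l" "l' \<le> Max (labels G {u, w'})"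
    using assms(1-3) by (auto simp: time_arcs_def temporal_graph_def)
  ultimately show ?thesis using assms(4,5) unfolding vim_set_def by fastforce
qed

theorem mainTheorem6:
  "\<exists>(P :: com) (C :: nat). \<forall>(G :: nat tgraph) (xs :: nat list).
     temporal_graph G \<longrightarrow> encodes xs G \<longrightarrow>
     (\<exists>(T :: nat) (s :: state).
        exec P (initial_state xs) T s \<and>
        (accepting s \<longleftrightarrow> temporal_hamiltonian G) \<and>
        (active_edges G \<noteq> {} \<longrightarrow>
           T \<le> C * (lifetime G ^ 2 * card (verts G) ^ 3 * 3 ^ (2 * vim_width G))))"
proof (rule exI[of _ main], rule exI[of _ 500], intro allI impI)
  fix G :: "nat tgraph" and xs :: "nat list"
  assume G: "temporal_graph G" and "encodes xs G"
  then obtain n es where verts: "verts G = {..<n}"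
    and dist: "distinct (map (\<lambda>(u, v, ts). {u, v}) es)"
    and edges: "edges G = set (map (\<lambda>(u, v, ts). {u, v}) es)"
    and labels: "\<forall>(u, v, ts) \<in> set es. distinct ts \<and> set ts = labels G {u, v}"
    and xs: "xs = n # length es # enc_edges es"
    unfolding encodes_def enc_edges_def by blast
  let ?E = "time_arcs G"
  have E: "set (arcs es) = ?E" using edges labels by (rule set_arcs)
  have edge: "u < n \<and> v < n \<and> u \<noteq> v" if "{u, v} \<in> edges G" for u v
    using that G verts by (fastforce simp: temporal_graph_def card_2_iff doubleton_eq_iff)
  have "u < n \<and> v < n \<and> u \<noteq> v \<and> distinct ts" if "(u, v, ts) \<in> set es" for u v ts
  proof -
    have "{u, v} \<in> edges G" unfolding edges using that by force
    then show ?thesis using edge labels that by blast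
  qed
  then have es: "\<forall>(u, v, ts) \<in> set es. u < n \<and> v < n \<and> u \<noteq> v \<and> distinct ts" by blast
  have arcs: "distinct (arcs es)" using dist es by (intro distinct_arcs) auto
  have "a < n \<and> b < n \<and> 1 \<le> l \<and> l \<le> lifetime G \<and> (b, a, l) \<in> ?E" if "(a, b, l) \<in> ?E" for a b l
  proof -
    have ab: "{a, b} \<in> edges G" "l \<in> labels G {a, b}" using that by (simp_all add: time_arcs_def)
    then have "l \<noteq> 0" using G unfolding temporal_graph_def by metis
    then show ?thesis
      using edge[OF ab(1)] label_le_lifetime[OF G ab] ab by (simp add: time_arcs_def insert_commute)
  qed
  then have E_bounds: "\<forall>(a, b, l) \<in> ?E. a < n \<and> b < n \<and> 1 \<le> l \<and> l \<le> lifetime G \<and> (b, a, l) \<in> ?E"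
    by blast
  have "finite (reach n ?E)"
    by (rule finite_reach) (use E_bounds in \<open>auto simp flip: E\<close>)
  let ?K = "card (reach n ?E)"
  let ?T = "30 + 16 * length es + 12 * length (arcs es) + 11 * n + ?K *
    (12 * n + 16 * length (arcs es) + (n + 1) * (12 * ?K + 12) + 19)"
  have "wp main (\<lambda>r m \<tau>. r rRes = of_bool (\<exists>t v. (t, {..<n}, v) \<in> reach n ?E) \<and> \<tau> \<le> ?T)
    (fst (initial_state xs)) (snd (initial_state xs)) 0"
    by (rule wp_main[OF xs arcs]) (use es E_bounds \<open>finite (reach n ?E)\<close> in \<open>auto simp: E\<close>)
  then obtain T r m where T: "exec main (initial_state xs) T (r, m)" "T \<le> ?T"
    and res: "r rRes = of_bool (\<exists>t v. (t, {..<n}, v) \<in> reach n ?E)"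
    unfolding wp_def by auto
  have "T \<le> 500 * (lifetime G ^ 2 * card (verts G) ^ 3 * 3 ^ (2 * vim_width G))" if active: "active_edges G \<noteq> {}"
  proof -
    \<comment> \<open>One active edge yields both \<open>1 \<le> n\<close> and
      \<open>1 \<le> lifetime G\<close>, which let the product absorb the additive terms.\<close>
    obtain e l where "e \<in> edges G" "l \<in> labels G e" using active by (auto simp: active_edges_def)
    moreover from this obtain u v where "e = {u, v}" using edges by auto
    ultimately have "(u, v, l) \<in> ?E" by (simp add: time_arcs_def)
    with E_bounds have "u < n \<and> 1 \<le> l \<and> l \<le> lifetime G" by blast
    then have pos: "1 \<le> n" "1 \<le> lifetime G" by linarith+
    have "?K \<le> n + lifetime G * n + lifetime G * 2 ^ vim_width G * n"
      by (rule card_reach_le[where F = "vim_set G"])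
        (use E_bounds in_vim_set[OF G] card_vim_set_le[OF G] in \<open>auto\<close>)
    moreover have "length (arcs es) \<le> n * n * lifetime G"
    proof -
      have "length (arcs es) = card ?E" using arcs E distinct_card by metis
      also have "\<dots> \<le> card ({..<n} \<times> {..<n} \<times> {1..lifetime G})"
        using E_bounds by (intro card_mono) auto
      finally show ?thesis by (simp add: card_cartesian_product mult.assoc)
    qed
    \<comment> \<open>Edges without labels are read but produce no arcs, so they have to be counted
      separately.\<close>
    moreover have "length es \<le> n * n"
    proof -
      have "length es = card (edges G)" using edges dist by (metis distinct_card length_map)
      also have "\<dots> \<le> card ((\<lambda>(u, v). {u, v}) ` ({..<n} \<times> {..<n}))"
        using es unfolding edges by (intro card_mono) fastforce+
      also have "\<dots> \<le> n * n"
        using card_image_le[of "{..<n} \<times> {..<n}" "\<lambda>(u, v). {u, v}"] by (simp add: card_cartesian_product)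
      finally show ?thesis .
    qed
    ultimately have "?T \<le> 500 * (lifetime G ^ 2 * n ^ 3 * 3 ^ (2 * vim_width G))"
      by (intro running_time_bound pos)
    then show ?thesis using T(2) by (simp add: verts)
  qed
  then show "\<exists>T s. exec main (initial_state xs) T s \<and> (accepting s \<longleftrightarrow> temporal_hamiltonian G) \<and>
      (active_edges G \<noteq> {} \<longrightarrow>
        T \<le> 500 * (lifetime G ^ 2 * card (verts G) ^ 3 * 3 ^ (2 * vim_width G)))"
    using T(1) res temporal_hamiltonian_iff_reach[OF verts G]
    by (intro exI[of _ T] exI[of _ "(r, m)"]) (simp add: accepting_def)
qed

end
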